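(* Let $T>0$, $m_0,m_f\in\mathbb R^n$, and let $\Sigma_0,\Sigma_f\succ 0$ be $n\times n$ positive definite matrices. Let $\rho_0=\mathcal N(\cdot\mid m_0,\Sigma_0)$ and $\rho_f=\mathcal N(\cdot\mid m_f,\Sigma_f)$, and put $\lambda(t)=(T-t)^{-1}$. Consider $$\dot x(t)=v(t,x(t)),\quad x(0)\sim\rho_0,\qquad v(t,x)=-\lambda(t)\int_{\mathcal S^{n-1}}\big(\theta^\top x-\mathcal T_t^\theta(\theta^\top x)\big)\,\theta\,\sigma(\mathrm d\theta),\quad (t,x)\in[0,T)\times\mathbb R^n,$$ where $\mathcal T_t^\theta$ is the optimal transport map from the projected density $\rho_\theta(t,\cdot)$ of the law $\rho(t,\cdot)$ of $x(t)$ to the projected density $\rho_{f,\theta}$ of $\rho_f$. Assume that this differential equation has a unique solution on $[0,T)$. Define, for $\Sigma\succ0$, $$K(t,\Sigma)=\lambda(t)\left[\int_{\mathcal S^{n-1}}\sqrt{\frac{\theta^\top\Sigma_f\theta}{\theta^\top\Sigma\theta}}\,\theta\theta^\top\sigma(\mathrm d\theta)-\frac1n I\right],$$ and assume also that the differential equation $$\dot\Sigma(t)=K(t,\Sigma(t))\Sigma(t)+\Sigma(t)K(t,\Sigma(t))^\top,\qquad \Sigma(0)=\Sigma_0,$$ admits a unique solution satisfying $\Sigma(t)\succ0$ for any $t\in(0,T]$. Let $m$ be the solution of $$\dot m(t)=-\frac{\lambda(t)}{n}(m(t)-m_f),\qquad m(0)=m_0,$$ and define, for $\Sigma\succ 0$,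 $$\eta(t,\Sigma)=-\lambda(t)\left[\left(\int_{\mathcal S^{n-1}}\sqrt{\frac{\theta^\top\Sigma_f\theta}{\theta^\top\Sigma\theta}}\,\theta\theta^\top\sigma(\mathrm d\theta)\right)m(t)-\frac1n m_f\right].$$ Then for any $t\in[0,T)$, $$\dot x(t)=K(t,\Sigma(t))x(t)+\eta(t,\Sigma(t)),\qquad x(t)\sim\mathcal N(m(t),\Sigma(t)).$$
   Context: $\mathcal S^{n-1}$ is the unit sphere in $\mathbb R^n$ and $\sigma$ is the uniform probability measure on it. $\mathcal N(\cdot\mid\mu,\Sigma)$ is the density of the Gaussian law $\mathcal N(\mu,\Sigma)$ with mean $\mu$ and covariance $\Sigma$. For $\theta\in\mathcal S^{n-1}$, $P_\theta(x)=\theta^\top x$; $\rho_\theta(t,\cdot)$ and $\rho_{f,\theta}$ denote the densities of the push-forwards $P_\theta\#\rho(t,\cdot)$ and $P_\theta\#\rho_f$. $\mathcal T_t^\theta:\mathbb R\to\mathbb R$ is the unique optimal transport map for the quadratic cost from $\rho_\theta(t,\cdot)$ to $\rho_{f,\theta}$, i.e. it pushes $\rho_\theta(t,\cdot)$ forward to $\rho_{f,\theta}$ and $W_2(\rho_\theta(t,\cdot),\rho_{f,\theta})^2=\int_{\mathbb R}|s-\mathcal T_t^\theta(s)|^2\rho_\theta(t,s)\,\mathrm ds$, where $W_2$ is the quadratic Wasserstein distance. Thus $v(t,\cdot)$ depends on the current law $\rho(t,\cdot)$ of $x(t)$. It is assumed throughout that $x(t)$ admits a density $\rho(t,\cdot)$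 solving the continuity equation $\partial_t\rho=-\nabla_x\cdot(\rho v)$, $\rho(0,\cdot)=\rho_0$, in the classical sense. $\Sigma\succ0$ means symmetric positive definite. *)

theory Defs
  imports "HOL-Probability.Probability"
begin

definition pos_def :: "real^'n^'n \<Rightarrow> bool" where
  "pos_def A \<longleftrightarrow> transpose A = A \<and> (\<forall>x. x \<noteq> 0 \<longrightarrow> 0 < x \<bullet> (A *v x))"

definition outer :: "real^'n \<Rightarrow> real^'n \<Rightarrow> real^'n^'n" where
  "outer u w = (\<chi> i j. u $ i * w $ j)"

definition gauss_density :: "real^'n \<Rightarrow> real^'n^'n \<Rightarrow> real^'n \<Rightarrow> real" where
  "gauss_density \<mu> S x =
     exp (- (1/2) * ((x - \<mu>) \<bullet> (matrix_inv S *v (x - \<mu>)))) / sqrt ((2 * pi) ^ CARD('n) * det S)"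

text \<open>The uniform probability measure on the unit sphere, as the law of \<open>x / |x|\<close> for \<open>x\<close>
  uniform on the unit ball. It is a measure on the Borel sets of the ambient space; the lemmas
  below show that it is carried by the sphere and is rotation invariant.\<close>

definition sphere_measure :: "(real^'n) measure" where
  "sphere_measure = distr (uniform_measure lborel (cball 0 1)) borel (\<lambda>x. x /\<^sub>R norm x)"

lemma sets_sphere_measure [simp, measurable_cong]: "sets sphere_measure = sets borel"
  by (simp add: sphere_measure_def)

lemma space_sphere_measure [simp]: "space sphere_measure = UNIV"
  by (simp add: sphere_measure_def)

lemma emeasure_unit_cball:
  "emeasure lborel (cball 0 1 :: (real^'n) set) \<noteq> 0"
  "emeasure lborel (cball 0 1 :: (real^'n) set) \<noteq> \<infinity>"
proof -
  have "0 < measure lborel (cball 0 1 :: (real^'n) set)"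
    by (rule content_cball_pos) simp
  then show "emeasure lborel (cball 0 1 :: (real^'n) set) \<noteq> 0"
    by (auto simp: measure_def)
  show "emeasure lborel (cball 0 1 :: (real^'n) set) \<noteq> \<infinity>"
    using emeasure_lborel_cball_finite[of "0 :: real^'n" 1] by simp
qed

lemma prob_space_sphere_measure: "prob_space (sphere_measure :: (real^'n) measure)"
  unfolding sphere_measure_def
  by (intro prob_space.prob_space_distr prob_space_uniform_measure emeasure_unit_cball) simp

lemma AE_sphere_measure: "AE \<theta> in (sphere_measure :: (real^'n) measure). \<theta> \<in> sphere 0 1"
proof -
  have "AE x in lborel. x \<noteq> (0 :: real^'n)"
    by (rule AE_lborel_singleton)
  then have "AE x in uniform_measure lborel (cball 0 1 :: (real^'n) set). x /\<^sub>R norm x \<in> sphere 0 1"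
    by (intro AE_uniform_measureI) (auto elim!: AE_mp)
  then show ?thesis
    unfolding sphere_measure_def by (subst AE_distr_iff) auto
qed

lemma nn_integral_lborel_affine:
  fixes g :: "real^'n \<Rightarrow> ennreal"
  assumes [measurable]: "g \<in> borel_measurable borel" and c: "\<bar>c\<bar> = 1"
  shows "(\<integral>\<^sup>+x. g (t + c *\<^sub>R x) \<partial>lborel) = (\<integral>\<^sup>+x. g x \<partial>lborel)"
proof -
  have "c \<noteq> 0" using c by auto
  have "lborel = distr lborel borel (\<lambda>x::real^'n. t + c *\<^sub>R x)"
    using lborel_affine[OF \<open>c \<noteq> 0\<close>, of t] c by (simp add: density_1)
  then have "(\<integral>\<^sup>+x. g x \<partial>lborel) = (\<integral>\<^sup>+x. g x \<partial>distr lborel borel (\<lambda>x::real^'n. t + c *\<^sub>R x))"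
    by simp
  then show ?thesis
    by (simp add: nn_integral_distr)
qed

lemma distr_lborel_orthogonal:
  fixes f :: "real^'n \<Rightarrow> real^'n"
  assumes f: "orthogonal_transformation f"
  shows "distr lborel borel f = lborel"
proof (rule measure_eqI)
  have lin: "linear f" by (rule orthogonal_transformation_linear[OF f])
  have fm [measurable]: "f \<in> borel_measurable borel"
    using lin by (intro borel_measurable_continuous_onI linear_continuous_on)
      (auto simp: linear_conv_bounded_linear)
  fix A :: "(real^'n) set" assume "A \<in> sets (distr lborel borel f)"
  then have A [measurable]: "A \<in> sets borel" by simp
  let ?B = "cball 0 1 :: (real^'n) set"
  have [measurable]: "?B \<in> sets borel" by simp
  have push: "emeasure (distr lborel borel f) C = (\<integral>\<^sup>+x. indicator C (f x) \<partial>lborel)"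
    if [measurable]: "C \<in> sets borel" for C
    by (simp add: nn_integral_distr flip: nn_integral_indicator)
  have shift: "emeasure lborel C = (\<integral>\<^sup>+y. indicator C (y - z) \<partial>lborel)"
    if [measurable]: "C \<in> sets borel" for C and z :: "real^'n"
    using nn_integral_lborel_affine[of "indicator C" 1 "- z"] by simp
  have "emeasure (distr lborel borel f) A * emeasure lborel ?B
      = (\<integral>\<^sup>+x. indicator A (f x) * emeasure lborel ?B \<partial>lborel)"
    by (simp add: push nn_integral_multc)
  also have "\<dots> = (\<integral>\<^sup>+x. \<integral>\<^sup>+y. indicator A (f x) * indicator ?B (y - f x) \<partial>lborel \<partial>lborel)"
    by (intro nn_integral_cong, subst shift) (auto simp: nn_integral_cmult)
  also have "\<dots> = (\<integral>\<^sup>+y. \<integral>\<^sup>+x. indicator A (f x) * indicator ?B (y - f x) \<partial>lborel \<partial>lborel)"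
    by (rule lborel_pair.Fubini') measurable
  also have "\<dots> = (\<integral>\<^sup>+y. \<integral>\<^sup>+x. indicator A (y - f x) * indicator ?B (f x) \<partial>lborel \<partial>lborel)"
  proof (rule nn_integral_cong)
    fix y
    have y: "f (inv f y - x) = y - f x" for x
      using orthogonal_transformation_surj[OF f] by (simp add: linear_diff[OF lin] surj_f_inv_f)
    show "(\<integral>\<^sup>+x. indicator A (f x) * indicator ?B (y - f x) \<partial>lborel)
        = (\<integral>\<^sup>+x. indicator A (y - f x) * (indicator ?B (f x) :: ennreal) \<partial>lborel)"
      using nn_integral_lborel_affine[of "\<lambda>x. indicator A (f x) * indicator ?B (y - f x)" "-1" "inv f y"]
      by (simp add: y)
  qed
  also have "\<dots> = (\<integral>\<^sup>+x. \<integral>\<^sup>+y. indicator A (y - f x) * indicator ?B (f x) \<partial>lborel \<partial>lborel)"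
    by (rule lborel_pair.Fubini'[symmetric]) measurable
  also have "\<dots> = (\<integral>\<^sup>+x. emeasure lborel A * indicator ?B (f x) \<partial>lborel)"
    by (intro nn_integral_cong, subst shift[OF A]) (auto simp: nn_integral_multc)
  also have "\<dots> = emeasure lborel A * emeasure lborel ?B"
    by (simp add: nn_integral_cmult orthogonal_transformation_norm[OF f] indicator_def
        flip: nn_integral_indicator)
  finally show "emeasure (distr lborel borel f) A = emeasure lborel A"
    using emeasure_unit_cball by (subst (asm) (1 2) mult.commute)
      (auto simp: ennreal_mult_cancel_left)
qed simp

lemma sphere_measure_rotation_invariant:
  fixes f :: "real^'n \<Rightarrow> real^'n"
  assumes f: "orthogonal_transformation f"
  shows "distr sphere_measure borel f = sphere_measure"
proof -
  have lin: "linear f" by (rule orthogonal_transformation_linear[OF f])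
  have fm [measurable]: "f \<in> borel_measurable borel"
    using lin by (intro borel_measurable_continuous_onI linear_continuous_on)
      (auto simp: linear_conv_bounded_linear)
  let ?U = "uniform_measure lborel (cball 0 1 :: (real^'n) set)"
  have U: "distr ?U borel f = ?U"
  proof (rule measure_eqI)
    fix A :: "(real^'n) set" assume "A \<in> sets (distr ?U borel f)"
    then have A [measurable]: "A \<in> sets borel" by simp
    have fA: "f -` A \<in> sets borel" by (rule measurable_sets_borel[OF fm A])
    have "emeasure lborel (cball 0 1 \<inter> f -` A) = emeasure lborel (f -` (cball 0 1 \<inter> A))"
      by (rule arg_cong[where f="emeasure lborel"]) (auto simp: orthogonal_transformation_norm[OF f])
    also have "\<dots> = emeasure (distr lborel borel f) (cball 0 1 \<inter> A)"
      by (subst emeasure_distr) auto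
    also have "\<dots> = emeasure lborel (cball 0 1 \<inter> A)"
      by (simp add: distr_lborel_orthogonal[OF f])
    finally show "emeasure (distr ?U borel f) A = emeasure ?U A"
      using fA by (subst emeasure_distr) auto
  qed simp
  have "distr sphere_measure borel f = distr ?U borel (\<lambda>x. f (x /\<^sub>R norm x))"
    unfolding sphere_measure_def by (subst distr_distr) (auto simp: o_def)
  also have "\<dots> = distr ?U borel (\<lambda>x. f x /\<^sub>R norm (f x))"
    by (simp add: orthogonal_transformation_norm[OF f] linear_scale[OF lin])
  also have "\<dots> = distr (distr ?U borel f) borel (\<lambda>x. x /\<^sub>R norm x)"
    by (subst distr_distr) (auto simp: o_def)
  finally show ?thesis
    by (simp add: U sphere_measure_def)
qed

definition projected_law :: "real^'n \<Rightarrow> (real^'n \<Rightarrow> real) \<Rightarrow> real measure" where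
  "projected_law \<theta> \<rho> = distr (density lborel (\<lambda>x. ennreal (\<rho> x))) borel (\<lambda>x. \<theta> \<bullet> x)"

definition couplings :: "'a measure \<Rightarrow> 'b measure \<Rightarrow> ('a \<times> 'b) measure set" where
  "couplings \<mu> \<nu> =
     {\<gamma>. sets \<gamma> = sets (\<mu> \<Otimes>\<^sub>M \<nu>) \<and> distr \<gamma> \<mu> fst = \<mu> \<and> distr \<gamma> \<nu> snd = \<nu>}"

text \<open>Real-valued, hence only meaningful when some coupling has finite cost.\<close>

definition wasserstein2 :: "'a::metric_space measure \<Rightarrow> 'a measure \<Rightarrow> real" where
  "wasserstein2 \<mu> \<nu> =
     sqrt (enn2real (INF \<gamma>\<in>couplings \<mu> \<nu>. \<integral>\<^sup>+z. ennreal ((dist (fst z) (snd z))\<^sup>2) \<partial>\<gamma>))"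

text \<open>The push-forward and cost conditions alone determine the map only up to null sets, whereas
  the velocity field below evaluates it pointwise for every direction. Monotonicity selects the
  usual representative; for a target with full support such as a Gaussian, it is unique on all
  of the real line. Integrability of the cost ensures that the Wasserstein distance is finite.\<close>

definition optimal_transport_map :: "real measure \<Rightarrow> real measure \<Rightarrow> (real \<Rightarrow> real) \<Rightarrow> bool" where
  "optimal_transport_map \<mu> \<nu> \<T> \<longleftrightarrow>
     mono \<T> \<and> \<T> \<in> measurable \<mu> \<nu> \<and> distr \<mu> \<nu> \<T> = \<nu> \<and>
     integrable \<mu> (\<lambda>s. \<bar>s - \<T> s\<bar>\<^sup>2) \<and>
     (wasserstein2 \<mu> \<nu>)\<^sup>2 = (\<integral>s. \<bar>s - \<T> s\<bar>\<^sup>2 \<partial>\<mu>)"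

definition rate :: "real \<Rightarrow> real \<Rightarrow> real" where
  "rate T t = inverse (T - t)"

definition sliced_velocity ::
    "real \<Rightarrow> (real \<Rightarrow> real^'n \<Rightarrow> real \<Rightarrow> real) \<Rightarrow> real \<Rightarrow> real^'n \<Rightarrow> real^'n" where
  "sliced_velocity T \<T> t x =
     - rate T t *\<^sub>R (\<integral>\<theta>. (\<theta> \<bullet> x - \<T> t \<theta> (\<theta> \<bullet> x)) *\<^sub>R \<theta> \<partial>sphere_measure)"

definition divergence :: "(real^'n \<Rightarrow> real^'n) \<Rightarrow> real^'n \<Rightarrow> real" where
  "divergence F x = (\<Sum>i\<in>UNIV. frechet_derivative F (at x) (axis i 1) $ i)"

definition classical_continuity_equation ::
    "real \<Rightarrow> (real^'n \<Rightarrow> real) \<Rightarrow> (real \<Rightarrow> real^'n \<Rightarrow> real^'n) \<Rightarrow> (real \<Rightarrow> real^'n \<Rightarrow> real) \<Rightarrow> bool" where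
  "classical_continuity_equation T \<rho>0 v \<rho> \<longleftrightarrow>
     \<rho> 0 = \<rho>0 \<and>
     continuous_on ({0..<T} \<times> UNIV) (\<lambda>(t, x). \<rho> t x) \<and>
     (\<exists>\<rho>'. continuous_on ({0..<T} \<times> UNIV) (\<lambda>(t, x). \<rho>' t x) \<and>
       (\<forall>t\<in>{0..<T}. \<forall>x.
          ((\<lambda>s. \<rho> s x) has_real_derivative \<rho>' t x) (at t within {0..<T}) \<and>
          (\<lambda>y. \<rho> t y *\<^sub>R v t y) differentiable (at x) \<and>
          \<rho>' t x = - divergence (\<lambda>y. \<rho> t y *\<^sub>R v t y) x))"

text \<open>The velocity depends on the law of the solution itself, so the density and the transport
  maps are part of what it means to be a solution. Integrability over the sphere is required
  because the Bochner integral of a non-integrable function is 0.\<close>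

definition sliced_flow_solution ::
    "'w measure \<Rightarrow> real \<Rightarrow> (real^'n \<Rightarrow> real) \<Rightarrow> (real^'n \<Rightarrow> real) \<Rightarrow> (real \<Rightarrow> 'w \<Rightarrow> real^'n) \<Rightarrow> bool" where
  "sliced_flow_solution M T \<rho>0 \<rho>f x \<longleftrightarrow>
     distributed M lborel (x 0) (\<lambda>z. ennreal (\<rho>0 z)) \<and>
     (\<exists>\<rho> \<T>.
        (\<forall>t\<in>{0..<T}. (\<forall>z. 0 \<le> \<rho> t z) \<and> distributed M lborel (x t) (\<lambda>z. ennreal (\<rho> t z))) \<and>
        (\<forall>t\<in>{0..<T}. \<forall>\<theta>\<in>sphere 0 1.
           optimal_transport_map (projected_law \<theta> (\<rho> t)) (projected_law \<theta> \<rho>f) (\<T> t \<theta>)) \<and>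
        (\<forall>t\<in>{0..<T}. \<forall>z.
           integrable sphere_measure (\<lambda>\<theta>. (\<theta> \<bullet> z - \<T> t \<theta> (\<theta> \<bullet> z)) *\<^sub>R \<theta>)) \<and>
        classical_continuity_equation T \<rho>0 (sliced_velocity T \<T>) \<rho> \<and>
        (\<forall>\<omega>\<in>space M. \<forall>t\<in>{0..<T}.
           ((\<lambda>s. x s \<omega>) has_vector_derivative sliced_velocity T \<T> t (x t \<omega>)) (at t within {0..<T})))"

definition sphere_matrix :: "real^'n^'n \<Rightarrow> real^'n^'n \<Rightarrow> real^'n^'n" where
  "sphere_matrix Sf S =
     (\<integral>\<theta>. sqrt ((\<theta> \<bullet> (Sf *v \<theta>)) / (\<theta> \<bullet> (S *v \<theta>))) *\<^sub>R outer \<theta> \<theta> \<partial>sphere_measure)"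

definition gain :: "real \<Rightarrow> real^'n^'n \<Rightarrow> real \<Rightarrow> real^'n^'n \<Rightarrow> real^'n^'n" where
  "gain T Sf t S = rate T t *\<^sub>R (sphere_matrix Sf S - (1 / real CARD('n)) *\<^sub>R mat 1)"

definition offset ::
    "real \<Rightarrow> real^'n^'n \<Rightarrow> real^'n \<Rightarrow> (real \<Rightarrow> real^'n) \<Rightarrow> real \<Rightarrow> real^'n^'n \<Rightarrow> real^'n" where
  "offset T Sf mf m t S =
     - rate T t *\<^sub>R (sphere_matrix Sf S *v m t - (1 / real CARD('n)) *\<^sub>R mf)"

definition mean_solution :: "real \<Rightarrow> real^'n \<Rightarrow> real^'n \<Rightarrow> (real \<Rightarrow> real^'n) \<Rightarrow> bool" where
  "mean_solution T m0 mf m \<longleftrightarrow>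
     m 0 = m0 \<and>
     (\<forall>t\<in>{0..<T}. (m has_vector_derivative - (rate T t / real CARD('n)) *\<^sub>R (m t - mf))
        (at t within {0..<T}))"

text \<open>The rate is singular at the final time, so the equation is imposed on \<open>[0, T)\<close> and the
  value at \<open>T\<close> is tied to it by continuity.\<close>

definition covariance_solution ::
    "real \<Rightarrow> real^'n^'n \<Rightarrow> real^'n^'n \<Rightarrow> (real \<Rightarrow> real^'n^'n) \<Rightarrow> bool" where
  "covariance_solution T S0 Sf S \<longleftrightarrow>
     S 0 = S0 \<and> continuous_on {0..T} S \<and> (\<forall>t\<in>{0<..T}. pos_def (S t)) \<and>
     (\<forall>t\<in>{0..<T}.
        (S has_vector_derivative gain T Sf t (S t) ** S t + S t ** transpose (gain T Sf t (S t)))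
        (at t within {0..<T}))"

end

theory Submission
  imports Defs
begin

text \<open>The projection of a Gaussian law to a line is a normal law, and the optimal map between two normal
laws on the line is the increasing affine map that matches means and standard deviations. Hence, as
long as the current law is \<open>\<N>(m(t), \<Sigma>(t))\<close>, the sliced velocity is affine in the
position, and integrating the affine maps over the sphere, where \<open>\<theta>\<theta>\<^sup>T\<close> has mean \<open>I/n\<close>,
gives \<open>K(t, \<Sigma>(t)) x + \<eta>(t, \<Sigma>(t)) = K(t, \<Sigma>(t)) (x - m(t)) + m'(t)\<close>. An affine velocity
field transports Gaussian laws to Gaussian laws, with the mean and the covariance governed by
exactly the two given equations. So there is a Gaussian candidate for the solution, and uniqueness
of the solution of the sliced flow forces the given \<open>x\<close> to be this candidate.

The candidate is \<open>y(t) = m(t) + \<Phi>(t) (x(0) - m\<^sub>0)\<close>, where \<open>\<Phi>' = K \<Phi>\<close> and \<open>\<Phi>(0) = I\<close>. Most of the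
work is to show that \<open>y\<close> is a solution in the full sense.

\<^item> The fundamental matrix \<open>\<Phi>\<close> is the sum of the Peano--Baker series (\<open>fundamental_matrix_exists\<close>).
  Together with the inverse \<open>\<Psi>\<close>, which solves the adjoint equation, it makes
  \<open>\<Psi> \<Sigma> \<Psi>\<^sup>T\<close> constant, so \<open>\<Sigma> = \<Phi> \<Sigma>\<^sub>0 \<Phi>\<^sup>T\<close> (\<open>covariance_by_fundamental_matrix\<close>).

\<^item> Lebesgue measure is scaled by \<open>\<bar>det A\<bar>\<close> under \<open>A\<close> (\<open>nn_integral_lborel_matrix\<close>), so \<open>y(t)\<close> has
  law \<open>\<N>(m(t), \<Phi>(t) \<Sigma>\<^sub>0 \<Phi>(t)\<^sup>T)\<close> (\<open>distr_gauss_density_affine\<close>).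

\<^item> Projections of Gaussians are normal (\<open>projected_law_gauss\<close>), and the affine map between normal
  laws is optimal because a pair of quadratic potentials certifies a matching lower bound on the
  cost of every coupling (\<open>optimal_transport_map_normal\<close>).

\<^item> The Gaussian densities solve the continuity equation (\<open>gaussian_continuity_equation\<close>); this uses
  the derivatives of \<open>det \<Sigma>\<close> (Liouville's formula) and of \<open>\<Sigma>\<^sup>-\<^sup>1\<close>.\<close>

section \<open>Linear matrix differential equations\<close>

lemma bounded_bilinear_matrix_mult:
  "bounded_bilinear ((**) :: real^'n^'m \<Rightarrow> real^'p^'n \<Rightarrow> real^'p^'m)"
  unfolding bilinear_conv_bounded_bilinear[symmetric] bilinear_def
  by (auto intro!: linearI simp: matrix_matrix_mult_def vec_eq_iff algebra_simps sum.distrib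
      sum_distrib_left)
  
lemma bounded_bilinear_matrix_vector_mult:
  "bounded_bilinear ((*v) :: real^'n^'m \<Rightarrow> real^'n \<Rightarrow> real^'m)"
  unfolding bilinear_conv_bounded_bilinear[symmetric] bilinear_def
  by (auto intro!: linearI simp: algebra_simps scaleR_matrix_vector_assoc)

lemma bounded_linear_transpose: "bounded_linear (transpose :: real^'n^'m \<Rightarrow> real^'m^'n)"
  by (auto intro!: linearI simp: linear_conv_bounded_linear[symmetric] transpose_def vec_eq_iff)

lemma has_vector_derivative_initial_interval:
  fixes f :: "real \<Rightarrow> 'a::real_normed_vector"
  assumes "(f has_vector_derivative f') (at t within {0..b})" and "0 \<le> t" "t < b" "b < T"
  shows "(f has_vector_derivative f') (at t within {0..<T})"
proof -
  have "at t within {0..<T} = at t within {0..b}"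
    by (rule at_within_nhd[of t "{..<b}"]) (use assms in auto)
  then show ?thesis using assms by simp
qed

text \<open>Near a point of \<open>[0, T)\<close> only some compact interval \<open>[0, b]\<close> with \<open>b < T\<close> matters. This is what
allows coefficients with a singularity at \<open>T\<close>, for which no bound holds on all of \<open>[0, T)\<close>.\<close>

lemma continuous_on_initial_intervals:
  fixes f :: "real \<Rightarrow> 'a::topological_space"
  assumes "\<And>b. b < T \<Longrightarrow> continuous_on {0..b} f"
  shows "continuous_on {0..<T} f"
  unfolding continuous_on_eq_continuous_within
proof
  fix t assume t: "t \<in> {0..<T}"
  define b where "b = (t + T) / 2"
  have b: "t < b" "b < T" using t by (auto simp: b_def)
  have "at t within {0..<T} = at t within {0..b}"
    by (rule at_within_nhd[of t "{..<b}"]) (use t b in auto)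
  moreover have "continuous (at t within {0..b}) f"
    using assms[OF b(2)] t b by (auto simp: continuous_on_eq_continuous_within)
  ultimately show "continuous (at t within {0..<T}) f"
    by (simp add: continuous_within)
qed

lemma integral_has_vector_derivative_initial_interval:
  fixes f :: "real \<Rightarrow> 'a::banach"
  assumes "continuous_on {0..<T} f" "t \<in> {0..<T}"
  shows "((\<lambda>u. integral {0..u} f) has_vector_derivative f t) (at t within {0..<T})"
proof -
  obtain b where b: "t < b" "b < T" using assms(2) dense by auto
  show ?thesis
    by (rule has_vector_derivative_initial_interval[where b=b],
        rule integral_has_vector_derivative)
      (use assms b in \<open>auto intro: continuous_on_subset\<close>)
qed

text \<open>The Picard iterates of \<open>X' = A X\<close>, \<open>X(0) = I\<close>, split into their increments; their sum is the
fundamental matrix.\<close>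

primrec peano_baker :: "(real \<Rightarrow> real^'n^'n) \<Rightarrow> nat \<Rightarrow> real \<Rightarrow> real^'n^'n" where
  "peano_baker A 0 t = mat 1"
| "peano_baker A (Suc k) t = integral {0..t} (\<lambda>s. A s ** peano_baker A k s)"

lemma continuous_on_peano_baker:
  assumes A: "continuous_on {0..<T} A"
  shows "continuous_on {0..<T} (peano_baker A k)"
proof (induction k)
  case 0
  have "peano_baker A 0 = (\<lambda>t. mat 1)" by (rule ext) simp
  then show ?case by simp
next
  case (Suc k)
  have "continuous_on {0..<T} (\<lambda>s. A s ** peano_baker A k s)"
    by (rule bounded_bilinear.continuous_on[OF bounded_bilinear_matrix_mult A Suc])
  then have "((\<lambda>t. integral {0..t} (\<lambda>s. A s ** peano_baker A k s)) has_vector_derivative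
      A t ** peano_baker A k t) (at t within {0..<T})" if "t \<in> {0..<T}" for t
    using that by (rule integral_has_vector_derivative_initial_interval)
  then have "continuous_on {0..<T} (\<lambda>t. integral {0..t} (\<lambda>s. A s ** peano_baker A k s))"
    unfolding continuous_on_eq_continuous_within
    by (intro ballI) (rule has_vector_derivative_continuous)
  then show ?case by simp
qed

lemma peano_baker_derivative:
  assumes "continuous_on {0..<T} A" and "t \<in> {0..<T}"
  shows "(peano_baker A k has_vector_derivative
      (case k of 0 \<Rightarrow> 0 | Suc j \<Rightarrow> A t ** peano_baker A j t)) (at t within {0..<T})"
proof (cases k)
  case 0
  have "peano_baker A 0 = (\<lambda>t. mat 1)" by (rule ext) simp
  then show ?thesis using 0 by simp
next
  case (Suc j)
  have "peano_baker A k = (\<lambda>t. integral {0..t} (\<lambda>s. A s ** peano_baker A j s))"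
    using Suc by (intro ext) simp
  then show ?thesis
    using Suc assms
    by (auto intro!: integral_has_vector_derivative_initial_interval
        bounded_bilinear.continuous_on[OF bounded_bilinear_matrix_mult] continuous_on_peano_baker)
qed

text \<open>Integrating \<open>(B s)\<^sup>k / k!\<close> against \<open>B\<close> reproduces the next term of the exponential series. Here
\<open>B\<close> bounds the left multiplication by \<open>A s\<close>, which absorbs the constant by which the norm fails to be
submultiplicative.\<close>

lemma norm_peano_baker_le:
  fixes A :: "real \<Rightarrow> real^'n^'n"
  assumes A: "continuous_on {0..<T} A" and b: "b < T"
    and B: "\<And>s X :: real^'n^'n. s \<in> {0..b} \<Longrightarrow> norm (A s ** X) \<le> B * norm X" and t: "t \<in> {0..b}"
  shows "norm (peano_baker A k t) \<le> norm (mat 1 :: real^'n^'n) * (B * t) ^ k / fact k"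
    (is "_ \<le> ?N * _ / _")
  using t
proof (induction k arbitrary: t)
  case 0
  show ?case by simp
next
  case (Suc k)
  have cont: "continuous_on {0..t} (\<lambda>s. A s ** peano_baker A k s)"
    by (rule continuous_on_subset[OF bounded_bilinear.continuous_on[OF bounded_bilinear_matrix_mult
          A continuous_on_peano_baker[OF A]]]) (use Suc.prems b in auto)
  have "(mat 1 :: real^'n^'n) $ i $ i \<noteq> 0 $ i $ i" for i :: 'n by (simp add: mat_def)
  then have "(mat 1 :: real^'n^'n) \<noteq> 0" by metis
  then have N: "0 < ?N" by simp
  have B0: "0 \<le> B"
    using order_trans[OF norm_ge_zero B[OF Suc.prems, of "mat 1"]] N by (simp add: zero_le_mult_iff)
  let ?g = "\<lambda>s. ?N * B ^ Suc k * s ^ k / fact k"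
  let ?c = "?N * B ^ Suc k / fact (Suc k)"
  have deriv: "((\<lambda>s. ?c * s ^ Suc k) has_vector_derivative ?g s) (at s within {0..t})" for s
  proof -
    have "((\<lambda>s. ?c * s ^ Suc k) has_real_derivative ?c * (real (Suc k) * s ^ k)) (at s within {0..t})"
      by (rule DERIV_cmult, rule has_field_derivative_at_within) (use DERIV_pow[of "Suc k" s] in simp)
    moreover have "?c * (real (Suc k) * s ^ k) = ?g s"
      by (simp del: of_nat_Suc add: fact_Suc)
    ultimately show ?thesis
      unfolding has_real_derivative_iff_has_vector_derivative[symmetric] by metis
  qed
  have "(?g has_integral (?c * t ^ Suc k - ?c * 0 ^ Suc k)) {0..t}"
    by (rule fundamental_theorem_of_calculus[OF _ deriv]) (use Suc.prems in auto)
  then have int: "(?g has_integral (?N * (B * t) ^ Suc k / fact (Suc k))) {0..t}"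
    by (simp add: power_mult_distrib mult_ac)
  have "norm (integral {0..t} (\<lambda>s. A s ** peano_baker A k s)) \<le> integral {0..t} ?g"
  proof (rule integral_norm_bound_integral)
    show "(\<lambda>s. A s ** peano_baker A k s) integrable_on {0..t}"
      by (rule integrable_continuous_real[OF cont])
    show "?g integrable_on {0..t}" using int by blast
    fix s assume s: "s \<in> {0..t}"
    then have sb: "s \<in> {0..b}" using Suc.prems by auto
    have "norm (A s ** peano_baker A k s) \<le> B * norm (peano_baker A k s)"
      by (rule B[OF sb])
    also have "\<dots> \<le> B * (?N * (B * s) ^ k / fact k)"
      by (rule mult_left_mono[OF Suc.IH[OF sb] B0])
    finally show "norm (A s ** peano_baker A k s) \<le> ?g s"
      by (simp add: power_mult_distrib mult_ac)
  qed
  also have "\<dots> = ?N * (B * t) ^ Suc k / fact (Suc k)"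
    using integral_unique[OF int] by simp
  finally show ?case by simp
qed

text \<open>On \<open>[0, b]\<close> the series of the derivatives is dominated by an exponential series. So it converges
uniformly, and the Peano--Baker series may be differentiated term by term. The derivative of each
increment is \<open>A\<close> times the preceding one, hence the sum of the derivatives is \<open>A\<close> times the sum of the
series.\<close>

lemma fundamental_matrix_exists:
  fixes A :: "real \<Rightarrow> real^'n^'n"
  assumes A: "continuous_on {0..<T} A"
  obtains \<Phi> where "\<Phi> 0 = mat 1"
    and "\<And>t. t \<in> {0..<T} \<Longrightarrow> (\<Phi> has_vector_derivative A t ** \<Phi> t) (at t within {0..<T})"
proof
  let ?J = "peano_baker A"
  let ?\<Phi> = "\<lambda>t. \<Sum>k. ?J k t"
  interpret mm: bounded_bilinear "(**) :: real^'n^'n \<Rightarrow> real^'n^'n \<Rightarrow> real^'n^'n"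
    by (rule bounded_bilinear_matrix_mult)
  have "?J k 0 = (if k = 0 then mat 1 else 0)" for k
    by (cases k) auto
  then show "?\<Phi> 0 = mat 1"
    using sums_unique[OF sums_single[of 0 "\<lambda>_. mat 1 :: real^'n^'n"]] by simp
  fix t assume t: "t \<in> {0..<T}"
  obtain b where b: "t < b" "b < T" using t dense by auto
  have "compact (A ` {0..b})"
    by (rule compact_continuous_image[OF continuous_on_subset[OF A]]) (use b in auto)
  then have "bounded (A ` {0..b})" by (rule compact_imp_bounded)
  then obtain C where C: "\<And>s. s \<in> {0..b} \<Longrightarrow> norm (A s) \<le> C"
    unfolding bounded_iff by blast
  from mm.pos_bounded obtain K
    where K: "0 < K" "\<And>(X :: real^'n^'n) (Y :: real^'n^'n). norm (X ** Y) \<le> norm X * norm Y * K"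
    by auto
  define B where "B = C * K"
  have B: "norm (A s ** X) \<le> B * norm X" if "s \<in> {0..b}" for s and X :: "real^'n^'n"
  proof -
    have "norm (A s ** X) \<le> norm (A s) * (norm X * K)" using K(2)[of "A s" X] by (simp add: mult_ac)
    also have "\<dots> \<le> C * (norm X * K)" using K(1) by (intro mult_right_mono C that) auto
    finally show ?thesis by (simp add: B_def mult_ac)
  qed
  have "0 \<le> C" using order_trans[OF norm_ge_zero C[of t]] t b by auto
  then have B0: "0 \<le> B" using K(1) by (simp add: B_def)
  define N where "N = norm (mat 1 :: real^'n^'n)"
  have bound: "norm (?J k s) \<le> N * (B * b) ^ k / fact k" if s: "s \<in> {0..b}" for k s
  proof -
    have "norm (?J k s) \<le> N * (B * s) ^ k / fact k"
      unfolding N_def by (rule norm_peano_baker_le[OF A b(2) B s])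
    also have "\<dots> \<le> N * (B * b) ^ k / fact k"
      by (intro divide_right_mono mult_left_mono power_mono mult_nonneg_nonneg)
        (use s B0 in \<open>auto simp: N_def\<close>)
    finally show ?thesis .
  qed
  have exps: "summable (\<lambda>k. N * (B * b) ^ k / fact k)"
    using summable_mult[OF summable_exp[of "B * b"], of N] by (simp add: divide_inverse mult_ac)
  have Jsum: "summable (\<lambda>k. ?J k s)" if "s \<in> {0..b}" for s
    by (rule summable_comparison_test'[OF exps bound[OF that]])
  \<comment> \<open>\<open>D\<close> lists the derivatives of the increments and \<open>c\<close> their bounds; the shift by one comes from \<open>peano_baker_derivative\<close>.\<close>
  define D where "D k s = (case k of 0 \<Rightarrow> 0 | Suc j \<Rightarrow> A s ** ?J j s)" for k s
  define c where "c k = (case k of 0 \<Rightarrow> 0 | Suc j \<Rightarrow> B * (N * (B * b) ^ j / fact j))" for k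
  have "summable (\<lambda>k. c (Suc k))" using summable_mult[OF exps, of B] by (simp add: c_def)
  then have csum: "summable c" by (simp only: summable_Suc_iff)
  have Dc: "norm (D k s) \<le> c k" if s: "s \<in> {0..b}" for k s
    using order_trans[OF B[OF s] mult_left_mono[OF bound[OF s] B0]]
    by (simp add: D_def c_def split: nat.split)
  have Dlim: "suminf (\<lambda>k. D k s) = A s ** ?\<Phi> s" if s: "s \<in> {0..b}" for s
  proof -
    have "summable (\<lambda>k. D k s)" by (rule summable_comparison_test'[OF csum Dc[OF s]])
    then have "suminf (\<lambda>k. D k s) = (\<Sum>k. A s ** ?J k s)"
      using suminf_split_head[of "\<lambda>k. D k s"] by (simp add: D_def)
    also have "\<dots> = A s ** ?\<Phi> s"
      by (rule bounded_linear.suminf[OF mm.bounded_linear_right Jsum[OF s], symmetric])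
    finally show ?thesis .
  qed
  have unif: "uniform_limit {0..b} (\<lambda>n s. \<Sum>i<n. D i s) (\<lambda>s. A s ** ?\<Phi> s) sequentially"
    using Weierstrass_m_test[where A="{0..b}" and f=D, OF Dc csum]
    by (subst uniform_limit_cong'[OF refl Dlim[symmetric]]) auto
  have "\<exists>g. \<forall>s\<in>{0..b}. (\<lambda>k. ?J k s) sums g s \<and>
      (g has_derivative (\<lambda>h. h *\<^sub>R (A s ** ?\<Phi> s))) (at s within {0..b})"
  proof (rule has_derivative_series)
    show "convex {0..b}" by simp
    show "(?J k has_derivative (\<lambda>h. h *\<^sub>R D k s)) (at s within {0..b})" if "s \<in> {0..b}" for k s
    proof -
      have "(?J k has_vector_derivative D k s) (at s within {0..<T})"
        unfolding D_def by (rule peano_baker_derivative[OF A]) (use that b in auto)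
      then show ?thesis
        unfolding has_vector_derivative_def[symmetric]
        by (rule has_vector_derivative_within_subset) (use b in auto)
    qed
    show "\<forall>\<^sub>F n in sequentially. \<forall>s\<in>{0..b}. \<forall>h.
        norm ((\<Sum>i<n. h *\<^sub>R D i s) - h *\<^sub>R (A s ** ?\<Phi> s)) \<le> e * norm h" if "0 < e" for e
      using uniform_limitD[OF unif that]
    proof eventually_elim
      case (elim n)
      show ?case
      proof (intro ballI allI)
        fix s h assume "s \<in> {0..b}"
        then have "norm ((\<Sum>i<n. D i s) - A s ** ?\<Phi> s) \<le> e"
          using elim by (auto simp: dist_norm intro: less_imp_le)
        then have "\<bar>h\<bar> * norm ((\<Sum>i<n. D i s) - A s ** ?\<Phi> s) \<le> \<bar>h\<bar> * e"
          by (intro mult_left_mono) auto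
        then show "norm ((\<Sum>i<n. h *\<^sub>R D i s) - h *\<^sub>R (A s ** ?\<Phi> s)) \<le> e * norm h"
          by (simp add: scaleR_diff_right[symmetric] scaleR_sum_right[symmetric] mult.commute)
      qed
    qed
    show "t \<in> {0..b}" using t b by auto
    then show "(\<lambda>k. ?J k t) sums ?\<Phi> t" using Jsum by (intro summable_sums)
  qed
  then obtain g where g: "\<And>s. s \<in> {0..b} \<Longrightarrow> (\<lambda>k. ?J k s) sums g s"
    "\<And>s. s \<in> {0..b} \<Longrightarrow> (g has_vector_derivative (A s ** ?\<Phi> s)) (at s within {0..b})"
    unfolding has_vector_derivative_def by blast
  have "(?\<Phi> has_vector_derivative (A t ** ?\<Phi> t)) (at t within {0..b})"
    by (rule has_vector_derivative_transform[OF _ _ g(2)])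
      (use t b g(1) in \<open>auto simp: sums_iff\<close>)
  then show "(?\<Phi> has_vector_derivative (A t ** ?\<Phi> t)) (at t within {0..<T})"
    by (rule has_vector_derivative_initial_interval) (use t b in auto)
qed

section \<open>Derivatives of determinants\<close>

lemma matrix_inv_eqI:
  fixes A B :: "real^'n^'n"
  assumes "A ** B = mat 1"
  shows "matrix_inv A = B"
proof -
  have B: "B ** A = mat 1" using assms matrix_left_right_inverse by blast
  have "invertible A" using assms B unfolding invertible_def by blast
  then have "A ** matrix_inv A = mat 1"
    unfolding invertible_def matrix_inv_def by (rule someI2_ex) simp
  then have "B ** (A ** matrix_inv A) = B" by simp
  then show ?thesis using B by (simp add: matrix_mul_assoc)
qed

lemma has_real_derivative_det:
  fixes A :: "real \<Rightarrow> real^'n^'n"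
  assumes A: "(A has_vector_derivative A') (at t within S)"
  shows "((\<lambda>s. det (A s)) has_real_derivative
     (\<Sum>i\<in>UNIV. det (\<chi> k. if k = i then A' $ i else A t $ k))) (at t within S)"
proof -
  let ?P = "{p. p permutes (UNIV :: 'n set)}"
  have entry: "((\<lambda>s. A s $ i $ j) has_derivative (\<lambda>h. h * A' $ i $ j)) (at t within S)" for i j
  proof -
    have "bounded_linear (\<lambda>X :: real^'n^'n. X $ i $ j)"
      by (rule bounded_linear_compose[OF bounded_linear_vec_nth bounded_linear_vec_nth])
    from bounded_linear.has_vector_derivative[OF this A] show ?thesis
      by (simp add: has_vector_derivative_def)
  qed
  have row: "(\<Prod>j\<in>UNIV. (\<chi> k. if k = i then A' $ i else A t $ k) $ j $ p j)
      = A' $ i $ p i * (\<Prod>j\<in>UNIV - {i}. A t $ j $ p j)" for i and p :: "'n \<Rightarrow> 'n"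
    by (subst prod.remove[where x=i]) (auto intro!: prod.cong)
  have "((\<lambda>s. det (A s)) has_derivative
      (\<lambda>h. \<Sum>p\<in>?P. of_int (sign p) *
          (\<Sum>i\<in>UNIV. (h * A' $ i $ p i) * (\<Prod>j\<in>UNIV - {i}. A t $ j $ p j)))) (at t within S)"
    unfolding det_def
    by (intro has_derivative_sum has_derivative_mult_right has_derivative_prod entry)
  also have "(\<lambda>h. \<Sum>p\<in>?P. of_int (sign p) *
          (\<Sum>i\<in>UNIV. (h * A' $ i $ p i) * (\<Prod>j\<in>UNIV - {i}. A t $ j $ p j)))
      = (\<lambda>h. (\<Sum>i\<in>UNIV. det (\<chi> k. if k = i then A' $ i else A t $ k)) * h)"
  proof
    fix h
    have "(\<Sum>p\<in>?P. of_int (sign p) *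
          (\<Sum>i\<in>UNIV. (h * A' $ i $ p i) * (\<Prod>j\<in>UNIV - {i}. A t $ j $ p j)))
        = (\<Sum>p\<in>?P. \<Sum>i\<in>UNIV. of_int (sign p) *
            (\<Prod>j\<in>UNIV. (\<chi> k. if k = i then A' $ i else A t $ k) $ j $ p j) * h)"
      by (simp only: row sum_distrib_left mult_ac)
    also have "\<dots> = (\<Sum>i\<in>UNIV. det (\<chi> k. if k = i then A' $ i else A t $ k)) * h"
      by (subst sum.swap) (simp only: det_def sum_distrib_right)
    finally show "(\<Sum>p\<in>?P. of_int (sign p) *
          (\<Sum>i\<in>UNIV. (h * A' $ i $ p i) * (\<Prod>j\<in>UNIV - {i}. A t $ j $ p j)))
        = (\<Sum>i\<in>UNIV. det (\<chi> k. if k = i then A' $ i else A t $ k)) * h" .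
  qed
  finally show ?thesis by (simp add: has_field_derivative_def)
qed

text \<open>If the rows of \<open>A\<close> move with velocity \<open>K A\<close>, then in the determinant with row \<open>i\<close> replaced by its
velocity only the multiple \<open>K\<^sub>i\<^sub>i\<close> of row \<open>i\<close> itself survives: the other summands repeat a row.\<close>

lemma liouville_det_derivative:
  fixes A :: "real \<Rightarrow> real^'n^'n"
  assumes A: "(A has_vector_derivative K ** A t) (at t within S)"
  shows "((\<lambda>s. det (A s)) has_real_derivative trace K * det (A t)) (at t within S)"
proof -
  have "det (\<chi> k. if k = i then (K ** A t) $ i else A t $ k) = K $ i $ i * det (A t)" for i
  proof -
    have r: "(K ** A t) $ i = (\<Sum>j\<in>UNIV. K $ i $ j *s (A t $ j))"
      by (simp add: vec_eq_iff matrix_matrix_mult_def)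
    have "det (\<chi> k. if k = i then (K ** A t) $ i else A t $ k)
        = (\<Sum>j\<in>UNIV. K $ i $ j * det (\<chi> k. if k = i then A t $ j else A t $ k))"
      unfolding r
      by (subst det_linear_row_sum[of UNIV i "\<lambda>_ j. K $ i $ j *s (A t $ j)"])
        (simp_all add: det_row_mul)
    also have "\<dots> = (\<Sum>j\<in>UNIV. if j = i then K $ i $ i * det (A t) else 0)"
    proof (rule sum.cong)
      fix j
      have "(\<chi> k. if k = i then A t $ i else A t $ k) = A t" by (simp add: vec_eq_iff)
      moreover have "det (\<chi> k. if k = i then A t $ j else A t $ k) = 0" if "j \<noteq> i"
        by (rule det_identical_rows[of i j]) (use that in \<open>auto simp: row_def vec_eq_iff\<close>)
      ultimately show "K $ i $ j * det (\<chi> k. if k = i then A t $ j else A t $ k)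
          = (if j = i then K $ i $ i * det (A t) else 0)" by auto
    qed simp
    finally show ?thesis by simp
  qed
  with has_real_derivative_det[OF A] show ?thesis
    by (simp add: trace_def sum_distrib_right)
qed

section \<open>Factorization of positive definite matrices\<close>

lemma pos_def_inner_commute:
  assumes "pos_def S"
  shows "x \<bullet> (S *v y) = y \<bullet> (S *v x)"
  by (metis assms dot_lmul_matrix inner_commute pos_def_def transpose_matrix_vector)

text \<open>A Gram--Schmidt argument in the inner product \<open>\<langle>x, y\<rangle> = x\<^sup>T S y\<close> that starts from a prescribed unit
vector \<open>u\<close>. A further vector is found by dimension: fewer than \<open>n\<close> vectors \<open>S b\<^sub>i\<close> leave a nonzero
vector orthogonal to all of them.\<close>

lemma pos_def_orthonormal_family:
  fixes S :: "real^'n^'n" and k :: 'n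
  assumes S: "pos_def S" and u: "u \<bullet> (S *v u) = 1"
  shows "\<exists>b. b k = u \<and> (\<forall>i\<in>UNIV. \<forall>j\<in>UNIV. b i \<bullet> (S *v b j) = (if i = j then 1 else 0))"
proof -
  let ?Q = "\<lambda>J. \<exists>b. b k = u \<and> (\<forall>i\<in>J. \<forall>j\<in>J. b i \<bullet> (S *v b j) = (if i = j then 1 else 0))"
  have "?Q (insert k J)" for J :: "'n set"
  proof (induction J rule: finite_induct[OF finite])
    case 1
    show ?case by (rule exI[of _ "\<lambda>_. u"]) (simp add: u)
  next
    case (2 l J)
    show ?case
    proof (cases "l = k")
      case True
      then show ?thesis using 2 by (simp add: insert_absorb)
    next
      case False
      let ?J = "insert k J"
      from 2 obtain b where b: "b k = u"
        "\<And>i j. i \<in> ?J \<Longrightarrow> j \<in> ?J \<Longrightarrow> b i \<bullet> (S *v b j) = (if i = j then 1 else 0)" by blast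
      have "dim ((\<lambda>i. S *v b i) ` ?J) \<le> card ((\<lambda>i. S *v b i) ` ?J)"
        by (rule dim_le_card) (auto intro: span_superset[THEN subsetD])
      also have "\<dots> \<le> card ?J" by (rule card_image_le) simp
      also have "\<dots> < CARD('n)" by (rule psubset_card_mono) (use 2 False in auto)
      finally have dim: "dim ((\<lambda>i. S *v b i) ` ?J) < DIM(real^'n)" by simp
      obtain x where x: "x \<noteq> 0" "\<And>y. y \<in> span ((\<lambda>i. S *v b i) ` ?J) \<Longrightarrow> orthogonal x y"
        using orthogonal_to_subspace_exists[OF dim] by metis
      have xb: "x \<bullet> (S *v b i) = 0" if "i \<in> ?J" for i
        using x(2)[of "S *v b i"] that by (auto simp: orthogonal_def intro!: span_base)
      have bx: "b i \<bullet> (S *v x) = 0" if "i \<in> ?J" for i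
        using xb[OF that] pos_def_inner_commute[OF S, of x "b i"] by simp
      have pos: "0 < x \<bullet> (S *v x)" using S x(1) by (simp add: pos_def_def)
      define y where "y = (1 / sqrt (x \<bullet> (S *v x))) *\<^sub>R x"
      have y1: "y \<bullet> (S *v y) = 1"
        using pos by (simp add: y_def matrix_vector_mult_scaleR)
      have yb: "y \<bullet> (S *v b i) = 0" "b i \<bullet> (S *v y) = 0" if "i \<in> ?J" for i
        using xb[OF that] bx[OF that] by (simp_all add: y_def matrix_vector_mult_scaleR)
      let ?b = "b(l := y)"
      have "?b k = u" using b(1) False by simp
      moreover have "?b i \<bullet> (S *v ?b j) = (if i = j then 1 else 0)"
        if "i \<in> insert k (insert l J)" "j \<in> insert k (insert l J)" for i j
        using that b(2)[of i j] y1 yb[of i] yb[of j] by (auto split: if_splits)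
      ultimately show ?thesis by blast
    qed
  qed
  from this[of UNIV] show ?thesis by simp
qed

text \<open>A square root of \<open>S\<close> that is adapted to a direction \<open>\<theta>\<close>. If \<open>Z\<close> is standard normal, then
\<open>\<theta> \<bullet> (L Z) = (L\<^sup>T \<theta>) \<bullet> Z\<close> is a multiple of the single coordinate \<open>Z\<^sub>k\<close>, so that its law can be read
off without convolutions. The matrix is \<open>L = S B\<close>, where the columns of \<open>B\<close> are an orthonormal basis
for \<open>S\<close> whose \<open>k\<close>-th member is proportional to \<open>\<theta>\<close>.\<close>

lemma pos_def_factorization:
  fixes S :: "real^'n^'n" and k :: 'n
  assumes S: "pos_def S" and \<theta>: "\<theta> \<noteq> 0"
  obtains L :: "real^'n^'n" where "invertible L" "L ** transpose L = S"
    "transpose L *v \<theta> = sqrt (\<theta> \<bullet> (S *v \<theta>)) *\<^sub>R axis k 1"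
proof -
  define c where "c = sqrt (\<theta> \<bullet> (S *v \<theta>))"
  have pos: "0 < \<theta> \<bullet> (S *v \<theta>)" using S \<theta> by (simp add: pos_def_def)
  then have c: "0 < c" "c * c = \<theta> \<bullet> (S *v \<theta>)" by (simp_all add: c_def)
  have u: "((1 / c) *\<^sub>R \<theta>) \<bullet> (S *v ((1 / c) *\<^sub>R \<theta>)) = 1"
    using c pos by (simp add: matrix_vector_mult_scaleR field_simps)
  obtain b where b: "b k = (1 / c) *\<^sub>R \<theta>"
    "\<And>i j. b i \<bullet> (S *v b j) = (if i = j then 1 else 0)"
    using pos_def_orthonormal_family[OF S u, of k] by auto
  define B :: "real^'n^'n" where "B = (\<chi> i j. b j $ i)"
  have Bv: "B *v axis j 1 = b j" for j
    by (simp add: B_def matrix_vector_mult_basis column_def vec_eq_iff)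
  have BSB: "transpose B ** S ** B = mat 1"
  proof -
    have "(transpose B ** S ** B) $ i $ j = axis i 1 \<bullet> ((transpose B ** S ** B) *v axis j 1)" for i j
      by (simp add: matrix_vector_mult_basis column_def inner_axis' )
    also have "\<dots> i j = b i \<bullet> (S *v b j)" for i j
    proof -
      have "axis i 1 \<bullet> ((transpose B ** S ** B) *v axis j 1) = ((S *v b j) v* B) \<bullet> axis i 1"
        by (simp add: matrix_vector_mul_assoc[symmetric] Bv inner_commute)
      also have "\<dots> = (S *v b j) \<bullet> b i" by (simp only: dot_lmul_matrix Bv)
      finally show ?thesis by (simp only: inner_commute)
    qed
    finally show ?thesis by (simp add: b(2) vec_eq_iff mat_def)
  qed
  have ST: "transpose S = S" using S by (simp add: pos_def_def)
  have BBS: "B ** (transpose B ** S) = mat 1"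
    using BSB matrix_left_right_inverse by blast
  show ?thesis
  proof (rule that[of "S ** B"])
    have LT: "transpose (S ** B) = transpose B ** S" by (simp add: matrix_transpose_mul ST)
    have "S ** B ** transpose B = mat 1"
      using arg_cong[OF BBS, of transpose] by (simp add: matrix_transpose_mul ST matrix_mul_assoc)
    then show "S ** B ** transpose (S ** B) = S"
      by (simp add: LT matrix_mul_assoc)
    show "invertible (S ** B)"
      unfolding invertible_left_inverse
      by (rule exI[of _ "transpose B"]) (use BSB in \<open>simp add: matrix_mul_assoc\<close>)
    have "\<theta> = c *\<^sub>R (B *v axis k 1)" using c by (simp add: Bv b(1))
    then have "transpose (S ** B) *v \<theta> = c *\<^sub>R ((transpose B ** S ** B) *v axis k 1)"
      by (simp add: LT matrix_vector_mult_scaleR matrix_vector_mul_assoc)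
    then show "transpose (S ** B) *v \<theta> = sqrt (\<theta> \<bullet> (S *v \<theta>)) *\<^sub>R axis k 1"
      by (simp add: BSB c_def)
  qed
qed

lemma pos_def_det:
  fixes S :: "real^'n^'n"
  assumes S: "pos_def S"
  shows "0 < det S"
proof -
  obtain L :: "real^'n^'n" where "invertible L" "L ** transpose L = S"
    by (rule pos_def_factorization[OF S, of "axis undefined 1" undefined]) (auto simp: axis_eq_0_iff)
  then show ?thesis
    using zero_less_power2[of "det L"] by (auto simp: invertible_det_nz det_mul power2_eq_square)
qed

section \<open>Lebesgue measure under linear maps\<close>

text \<open>Both sides compute the double integral of \<open>1\<^sub>A(f x) 1\<^sub>B(y - f x)\<close>, by translation invariance: on the
left the integral over \<open>y\<close> is done first; on the right the substitution \<open>x \<mapsto> f\<^sup>-\<^sup>1 y - x\<close> comes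
first. It follows that a linear bijection scales the measures of all sets by the same factor, which
can be determined from a single test set \<open>B\<close>.\<close>

lemma emeasure_lborel_linear_vimage:
  fixes f :: "real^'n \<Rightarrow> real^'n"
  assumes lin: "linear f" and surj: "surj f"
    and A [measurable]: "A \<in> sets borel" and B [measurable]: "B \<in> sets borel"
  shows "emeasure lborel (f -` A) * emeasure lborel B = emeasure lborel A * emeasure lborel (f -` B)"
proof -
  have fm [measurable]: "f \<in> borel_measurable borel"
    using lin by (intro borel_measurable_continuous_onI linear_continuous_on)
      (auto simp: linear_conv_bounded_linear)
  have push: "emeasure lborel (f -` C) = (\<integral>\<^sup>+x. indicator C (f x) \<partial>lborel)"
    if [measurable]: "C \<in> sets borel" for C
    by (subst nn_integral_indicator[symmetric])
      (auto simp: indicator_def intro!: nn_integral_cong measurable_sets_borel[OF fm])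
  have shift: "emeasure lborel C = (\<integral>\<^sup>+y. indicator C (y - z) \<partial>lborel)"
    if [measurable]: "C \<in> sets borel" for C and z :: "real^'n"
    using nn_integral_lborel_affine[of "indicator C" 1 "- z"] by simp
  have "emeasure lborel (f -` A) * emeasure lborel B
      = (\<integral>\<^sup>+x. indicator A (f x) * emeasure lborel B \<partial>lborel)"
    by (simp add: push nn_integral_multc)
  also have "\<dots> = (\<integral>\<^sup>+x. \<integral>\<^sup>+y. indicator A (f x) * indicator B (y - f x) \<partial>lborel \<partial>lborel)"
    by (intro nn_integral_cong, subst shift) (auto simp: nn_integral_cmult)
  also have "\<dots> = (\<integral>\<^sup>+y. \<integral>\<^sup>+x. indicator A (f x) * indicator B (y - f x) \<partial>lborel \<partial>lborel)"
    by (rule lborel_pair.Fubini') measurable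
  also have "\<dots> = (\<integral>\<^sup>+y. \<integral>\<^sup>+x. indicator A (y - f x) * indicator B (f x) \<partial>lborel \<partial>lborel)"
  proof (rule nn_integral_cong)
    fix y
    have y: "f (inv f y - x) = y - f x" for x
      by (simp add: linear_diff[OF lin] surj_f_inv_f[OF surj])
    show "(\<integral>\<^sup>+x. indicator A (f x) * indicator B (y - f x) \<partial>lborel)
        = (\<integral>\<^sup>+x. indicator A (y - f x) * (indicator B (f x) :: ennreal) \<partial>lborel)"
      using nn_integral_lborel_affine[of "\<lambda>x. indicator A (f x) * indicator B (y - f x)" "-1" "inv f y"]
      by (simp add: y)
  qed
  also have "\<dots> = (\<integral>\<^sup>+x. \<integral>\<^sup>+y. indicator A (y - f x) * indicator B (f x) \<partial>lborel \<partial>lborel)"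
    by (rule lborel_pair.Fubini'[symmetric]) measurable
  also have "\<dots> = (\<integral>\<^sup>+x. emeasure lborel A * indicator B (f x) \<partial>lborel)"
    by (intro nn_integral_cong, subst shift[OF A]) (auto simp: nn_integral_multc)
  also have "\<dots> = emeasure lborel A * emeasure lborel (f -` B)"
    by (simp add: nn_integral_cmult push)
  finally show ?thesis .
qed

text \<open>The scaling factor of an involution \<open>J\<close> is 1, because \<open>J\<close> preserves the test set \<open>C \<union> J\<^sup>-\<^sup>1 C\<close>, with \<open>C\<close>
the unit ball.\<close>

lemma distr_lborel_linear_involution:
  fixes J :: "real^'n \<Rightarrow> real^'n"
  assumes lin: "linear J" and inv: "\<And>x. J (J x) = x"
  shows "distr lborel borel J = lborel"
proof (rule measure_eqI)
  have blin: "bounded_linear J" using lin by (simp add: linear_conv_bounded_linear)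
  have Jm [measurable]: "J \<in> borel_measurable borel"
    using blin by (intro borel_measurable_continuous_onI linear_continuous_on)
  have surj: "surj J" using inv by (metis surjI)
  fix A :: "(real^'n) set" assume "A \<in> sets (distr lborel borel J)"
  then have A: "A \<in> sets borel" by simp
  let ?C = "cball 0 1 :: (real^'n) set"
  let ?B = "?C \<union> J -` ?C"
  have B: "?B \<in> sets borel" using measurable_sets_borel[OF Jm, of ?C] by simp
  have JB: "J -` ?B = ?B" by (auto simp: inv)
  have "emeasure lborel ?C \<le> emeasure lborel ?B" by (rule emeasure_mono) (use B in auto)
  then have B0: "emeasure lborel ?B \<noteq> 0" using emeasure_unit_cball(1)[where 'n='n] by auto
  have "J -` ?C = J ` ?C" using inv by (auto simp: image_iff) (metis inv mem_cball_0)
  then have "bounded ?B" using bounded_linear_image[OF _ blin, of ?C] by simp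
  then have Bfin: "emeasure lborel ?B \<noteq> \<infinity>" using emeasure_bounded_finite[of ?B] by simp
  have "emeasure lborel (J -` A) * emeasure lborel ?B = emeasure lborel A * emeasure lborel ?B"
    using emeasure_lborel_linear_vimage[OF lin surj A B] by (simp only: JB)
  then have "emeasure lborel (J -` A) = emeasure lborel A"
    using B0 Bfin by (subst (asm) (1 2) mult.commute) (auto simp: ennreal_mult_cancel_left)
  then show "emeasure (distr lborel borel J) A = emeasure lborel A"
    using A by (simp add: emeasure_distr)
qed simp

lemma measurable_matrix_vector_mult [measurable]:
  "(\<lambda>x. (A :: real^'n^'m) *v x) \<in> borel_measurable borel"
  by (intro borel_measurable_continuous_onI linear_continuous_on matrix_vector_mul_bounded_linear)

text \<open>The class of matrices for which the formula holds is closed under products, so elementary matrices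
suffice. Diagonal ones are a coordinatewise rescaling, and transpositions are involutions. A shear \<open>E\<close>
is a product of two involutions: if \<open>E\<close> adds \<open>x\<^sub>n\<close> to \<open>x\<^sub>m\<close> and \<open>D\<close> changes the sign of
\<open>x\<^sub>n\<close>, then \<open>D E D = E\<^sup>-\<^sup>1\<close>, so \<open>D E\<close> is an involution and \<open>E = D (D E)\<close>.\<close>

lemma nn_integral_lborel_matrix:
  fixes A :: "real^'n^'n"
  assumes "invertible A" and "g \<in> borel_measurable borel"
  shows "(\<integral>\<^sup>+x. ennreal \<bar>det A\<bar> * g (A *v x) \<partial>lborel) = (\<integral>\<^sup>+x. g x \<partial>lborel)"
proof -
  let ?P = "\<lambda>A :: real^'n^'n. invertible A \<longrightarrow> (\<forall>g \<in> borel_measurable borel.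
      (\<integral>\<^sup>+x. ennreal \<bar>det A\<bar> * g (A *v x) \<partial>lborel) = (\<integral>\<^sup>+x. g x \<partial>lborel))"
  have mult: "?P (A ** B)" if A: "?P A" and B: "?P B" for A B
  proof (intro impI ballI)
    assume "invertible (A ** B)"
    then have inv: "invertible A" "invertible B" by (auto simp: invertible_det_nz det_mul)
    fix g :: "real^'n \<Rightarrow> ennreal" assume g [measurable]: "g \<in> borel_measurable borel"
    have m [measurable]: "(\<lambda>y. ennreal \<bar>det A\<bar> * g (A *v y)) \<in> borel_measurable borel" by measurable
    have "(\<integral>\<^sup>+x. ennreal \<bar>det (A ** B)\<bar> * g ((A ** B) *v x) \<partial>lborel)
      = (\<integral>\<^sup>+x. ennreal \<bar>det B\<bar> * (ennreal \<bar>det A\<bar> * g (A *v (B *v x))) \<partial>lborel)"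
      by (simp add: det_mul abs_mult ennreal_mult matrix_vector_mul_assoc mult_ac)
    also have "\<dots> = (\<integral>\<^sup>+y. ennreal \<bar>det A\<bar> * g (A *v y) \<partial>lborel)"
      by (rule B[THEN mp, THEN bspec, OF inv(2) m])
    also have "\<dots> = (\<integral>\<^sup>+x. g x \<partial>lborel)" by (rule A[THEN mp, THEN bspec, OF inv(1) g])
    finally show "(\<integral>\<^sup>+x. ennreal \<bar>det (A ** B)\<bar> * g ((A ** B) *v x) \<partial>lborel) = (\<integral>\<^sup>+x. g x \<partial>lborel)" .
  qed
  have preserving: "?P A" if "distr lborel borel ((*v) A) = lborel" "\<bar>det A\<bar> = 1" for A
  proof (intro impI ballI)
    fix g :: "real^'n \<Rightarrow> ennreal" assume [measurable]: "g \<in> borel_measurable borel"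
    have "(\<integral>\<^sup>+x. g x \<partial>lborel) = (\<integral>\<^sup>+x. g x \<partial>distr lborel borel ((*v) A))" using that by simp
    also have "\<dots> = (\<integral>\<^sup>+x. g (A *v x) \<partial>lborel)" by (simp add: nn_integral_distr)
    finally show "(\<integral>\<^sup>+x. ennreal \<bar>det A\<bar> * g (A *v x) \<partial>lborel) = (\<integral>\<^sup>+x. g x \<partial>lborel)"
      using that by simp
  qed
  have involution: "?P A" if A: "A ** A = mat 1" for A
  proof (rule preserving)
    show "distr lborel borel ((*v) A) = lborel"
      by (rule distr_lborel_linear_involution)
        (simp_all add: matrix_vector_mul_linear matrix_vector_mul_assoc A)
    have "(det A)\<^sup>2 = 1" using arg_cong[OF A, of det] by (simp add: det_mul power2_eq_square)
    then show "\<bar>det A\<bar> = 1" by (simp add: abs_square_eq_1)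
  qed
  have diagonal: "?P A" if A: "\<And>i j. i \<noteq> j \<Longrightarrow> A$i$j = 0" for A
  proof (intro impI ballI)
    assume "invertible A"
    then have "(\<Prod>i\<in>UNIV. A$i$i) \<noteq> 0" using A by (simp add: invertible_det_nz det_diagonal)
    then have nz: "A$i$i \<noteq> 0" for i by simp
    fix g :: "real^'n \<Rightarrow> ennreal" assume [measurable]: "g \<in> borel_measurable borel"
    define c :: "real^'n \<Rightarrow> real" where "c b = b \<bullet> (A *v b)" for b
    have cA: "c (axis i 1) = A$i$i" for i
      by (simp add: c_def matrix_vector_mult_basis column_def inner_axis')
    have rep: "A *v x = 0 + (\<Sum>b\<in>Basis. (c b * (x \<bullet> b)) *\<^sub>R b)" for x
    proof -
      have "(\<Sum>b\<in>Basis. (c b * (x \<bullet> b)) *\<^sub>R b) = (\<Sum>i\<in>UNIV. (A$i$i * x$i) *\<^sub>R axis i 1)"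
        by (simp add: Basis_vec_def sum.UNION_disjoint axis_eq_axis cA cart_eq_inner_axis)
      also have "\<dots> = A *v x"
      proof (subst vec_eq_iff, rule allI)
        fix i
        have "(\<Sum>j\<in>UNIV. A$i$j * x$j) = A$i$i * x$i"
          using A by (subst sum.remove[of _ i]) (auto intro!: sum.neutral)
        then show "(\<Sum>i\<in>UNIV. (A$i$i * x$i) *\<^sub>R axis i 1) $ i = (A *v x) $ i"
          by (simp add: matrix_vector_mult_def axis_def if_distrib[of "(*) _"] cong: if_cong)
      qed
      finally show ?thesis by simp
    qed
    have detc: "(\<Prod>b\<in>Basis. \<bar>c b\<bar>) = \<bar>det A\<bar>"
      using A by (simp add: det_diagonal Basis_vec_def prod.UNION_disjoint axis_eq_axis cA abs_prod)
    have "lborel = density (distr lborel borel (\<lambda>x. 0 + (\<Sum>b\<in>Basis. (c b * (x \<bullet> b)) *\<^sub>R b)))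
        (\<lambda>_. ennreal (\<Prod>b\<in>Basis. \<bar>c b\<bar>))"
      by (rule lborel_affine_euclidean) (auto simp: Basis_vec_def cA nz)
    then have "lborel = density (distr lborel borel ((*v) A)) (\<lambda>_. ennreal \<bar>det A\<bar>)"
      by (simp only: rep[symmetric] detc)
    then have "(\<integral>\<^sup>+x. g x \<partial>lborel) = (\<integral>\<^sup>+x. g x \<partial>density (distr lborel borel ((*v) A)) (\<lambda>_. ennreal \<bar>det A\<bar>))"
      by simp
    also have "\<dots> = (\<integral>\<^sup>+x. ennreal \<bar>det A\<bar> * g (A *v x) \<partial>lborel)"
      by (simp add: nn_integral_density nn_integral_distr)
    finally show "(\<integral>\<^sup>+x. ennreal \<bar>det A\<bar> * g (A *v x) \<partial>lborel) = (\<integral>\<^sup>+x. g x \<partial>lborel)" by simp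
  qed
  have "?P A"
  proof (rule induct_matrix_elementary_alt[of ?P])
    fix A B :: "real^'n^'n" assume "?P A" "?P B"
    then show "?P (A ** B)" by (rule mult)
  next
    fix A :: "real^'n^'n" and i assume "row i A = 0"
    then show "?P A" by (simp add: invertible_det_nz det_zero_row)
  next
    fix A :: "real^'n^'n" assume "\<And>i j. i \<noteq> j \<Longrightarrow> A$i$j = 0"
    then show "?P A" by (rule diagonal)
  next
    fix m n :: 'n
    let ?W = "\<chi> i j. mat 1 $ i $ Transposition.transpose m n j :: real^'n^'n"
    have "mat 1 $ i $ Transposition.transpose m n j * x $ j
        = (if j = Transposition.transpose m n i then x $ j else 0)" for i j and x :: "real^'n"
      by (auto simp: mat_def)
    then have "(?W *v x) $ i = x $ Transposition.transpose m n i" for x i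
      by (simp add: matrix_vector_mult_def)
    then show "?P ?W"
      by (intro involution) (simp add: matrix_eq matrix_vector_mul_assoc[symmetric] vec_eq_iff)
  next
    fix m n :: 'n assume mn: "m \<noteq> n"
    define E :: "real^'n^'n" where "E = (\<chi> i j. of_bool (i = m \<and> j = n \<or> i = j))"
    define D :: "real^'n^'n" where "D = (\<chi> i j. if i = j then (if i = n then -1 else 1) else 0)"
    have E: "(E *v x) $ i = x $ i + (if i = m then x $ n else 0)" for x i
    proof -
      have "of_bool (i = m \<and> j = n \<or> i = j) * x$j
        = (if j = i then x$j else 0) + (if j = n then (if i = m then x$j else 0) else 0)" for j
        using mn by auto
      then show ?thesis by (simp add: E_def matrix_vector_mult_def sum.distrib)
    qed
    have D: "(D *v x) $ i = (if i = n then - x $ i else x $ i)" for x i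
      by (simp add: D_def matrix_vector_mult_def if_distrib[of "\<lambda>y. y * _"] cong: if_cong)
    have "?P D" by (rule diagonal) (simp add: D_def)
    moreover have "?P (D ** E)"
      by (rule involution)
        (use mn in \<open>simp add: matrix_eq matrix_vector_mul_assoc[symmetric] vec_eq_iff E D\<close>)
    moreover have "D ** (D ** E) = E"
      by (simp add: matrix_eq matrix_vector_mul_assoc[symmetric] vec_eq_iff E D)
    ultimately show "?P (\<chi> i j. of_bool (i = m \<and> j = n \<or> i = j))"
      using mult[of D "D ** E"] by (simp only: E_def)
  qed
  then show ?thesis using assms by blast
qed

lemma nn_integral_lborel_affine_matrix:
  fixes A :: "real^'n^'n" and g :: "real^'n \<Rightarrow> ennreal"
  assumes A: "invertible A" and [measurable]: "g \<in> borel_measurable borel"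
  shows "(\<integral>\<^sup>+x. ennreal \<bar>det A\<bar> * g (a + A *v x) \<partial>lborel) = (\<integral>\<^sup>+x. g x \<partial>lborel)"
  using nn_integral_lborel_matrix[OF A, of "\<lambda>y. g (a + y)"] nn_integral_lborel_affine[of g 1 a]
  by simp

lemma distr_density_affine_matrix:
  fixes A :: "real^'n^'n" and f g :: "real^'n \<Rightarrow> real"
  assumes A: "invertible A" and [measurable]: "g \<in> borel_measurable borel"
    and fg: "\<And>x. f x = \<bar>det A\<bar> * g (a + A *v x)"
  shows "distr (density lborel (\<lambda>x. ennreal (f x))) borel (\<lambda>x. a + A *v x)
    = density lborel (\<lambda>x. ennreal (g x))"
proof (rule measure_eqI)
  have h [measurable]: "(\<lambda>x. a + A *v x) \<in> borel_measurable borel"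
    by (intro borel_measurable_continuous_onI continuous_intros linear_continuous_on) simp
  have f [measurable]: "f \<in> borel_measurable borel" unfolding fg[abs_def] by measurable
  fix E assume "E \<in> sets (distr (density lborel (\<lambda>x. ennreal (f x))) borel (\<lambda>x. a + A *v x))"
  then have E [measurable]: "E \<in> sets borel" by simp
  have "emeasure (distr (density lborel (\<lambda>x. ennreal (f x))) borel (\<lambda>x. a + A *v x)) E
      = (\<integral>\<^sup>+x. ennreal (f x) * indicator E (a + A *v x) \<partial>lborel)"
    by (simp add: nn_integral_distr nn_integral_density flip: nn_integral_indicator)
  also have "\<dots> = (\<integral>\<^sup>+x. ennreal \<bar>det A\<bar> * (ennreal (g (a + A *v x)) * indicator E (a + A *v x)) \<partial>lborel)"
    by (simp add: fg ennreal_mult' mult.assoc)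
  also have "\<dots> = (\<integral>\<^sup>+x. ennreal (g x) * indicator E x \<partial>lborel)"
    by (rule nn_integral_lborel_affine_matrix[OF A]) measurable
  finally show "emeasure (distr (density lborel (\<lambda>x. ennreal (f x))) borel (\<lambda>x. a + A *v x)) E
      = emeasure (density lborel (\<lambda>x. ennreal (g x))) E"
    by (simp add: emeasure_density)
qed simp

section \<open>Gaussian laws and their projections\<close>

lemma continuous_on_gauss_density: "continuous_on X (gauss_density \<mu> S)"
  unfolding gauss_density_def[abs_def] divide_inverse
  by (intro continuous_intros linear_continuous_on_compose[OF _ matrix_vector_mul_linear])

lemma measurable_gauss_density [measurable]: "gauss_density \<mu> S \<in> borel_measurable borel"
  by (intro borel_measurable_continuous_onI continuous_on_gauss_density)

text \<open>The quadratic form in the exponent is invariant under the affine map, and the determinant of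
\<open>A S A\<^sup>T\<close> contributes the factor \<open>\<bar>det A\<bar>\<close> to the normalizing constant. With the preceding change of
variables this makes the family of Gaussians closed under affine bijections.\<close>

lemma gauss_density_affine:
  fixes A S :: "real^'n^'n"
  assumes A: "invertible A" and S: "pos_def S"
  shows "gauss_density \<mu> S x = \<bar>det A\<bar> * gauss_density \<nu> (A ** S ** transpose A) (\<nu> + A *v (x - \<mu>))"
proof -
  obtain A' where A': "A' ** A = mat 1" "A ** A' = mat 1"
    using A unfolding invertible_def by blast
  have detA: "det A \<noteq> 0" using A by (simp add: invertible_det_nz)
  have "invertible S" using pos_def_det[OF S] by (simp add: invertible_det_nz)
  then obtain P where P: "S ** P = mat 1" unfolding invertible_def by blast
  have iS: "matrix_inv S = P" by (rule matrix_inv_eqI[OF P])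
  have tA: "transpose A ** transpose A' = mat 1"
    using A'(1) by (metis matrix_transpose_mul transpose_mat)
  have "A ** S ** transpose A ** (transpose A' ** P ** A') = A ** (S ** (transpose A ** transpose A') ** P) ** A'"
    by (simp only: matrix_mul_assoc)
  also have "\<dots> = mat 1" by (simp add: tA P A')
  finally have inv: "matrix_inv (A ** S ** transpose A) = transpose A' ** P ** A'"
    by (rule matrix_inv_eqI)
  have "(A *v y) \<bullet> ((transpose A' ** P ** A') *v (A *v y)) = y \<bullet> (P *v y)" for y
  proof -
    have "(A *v y) \<bullet> ((transpose A' ** P ** A') *v (A *v y))
       = (A *v y) \<bullet> (transpose A' *v (P *v ((A' ** A) *v y)))"
      by (simp only: matrix_vector_mul_assoc matrix_mul_assoc)
    also have "\<dots> = ((P *v y) v* A') \<bullet> (A *v y)" by (simp add: A' inner_commute)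
    also have "\<dots> = (P *v y) \<bullet> ((A' ** A) *v y)" by (simp only: dot_lmul_matrix matrix_vector_mul_assoc)
    finally show ?thesis by (simp add: A' inner_commute)
  qed
  moreover have "sqrt ((2 * pi) ^ CARD('n) * det (A ** S ** transpose A))
     = \<bar>det A\<bar> * sqrt ((2 * pi) ^ CARD('n) * det S)"
    by (simp add: det_mul real_sqrt_mult)
  ultimately show ?thesis
    using detA by (simp add: gauss_density_def inv iS)
qed

lemma pos_def_mat_1: "pos_def (mat 1 :: real^'n^'n)"
  by (simp add: pos_def_def)

lemma distr_gauss_density_affine:
  fixes A S :: "real^'n^'n"
  assumes A: "invertible A" and S: "pos_def S"
  shows "distr (density lborel (\<lambda>x. ennreal (gauss_density \<mu> S x))) borel (\<lambda>x. \<nu> + A *v (x - \<mu>))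
    = density lborel (\<lambda>x. ennreal (gauss_density \<nu> (A ** S ** transpose A) x))"
proof -
  have "(\<lambda>x. \<nu> + A *v (x - \<mu>)) = (\<lambda>x. (\<nu> - A *v \<mu>) + A *v x)"
    by (simp add: fun_eq_iff matrix_vector_mult_diff_distrib)
  then show ?thesis
    by (simp only:) (rule distr_density_affine_matrix[OF A],
      simp_all add: gauss_density_affine[OF A S, of \<mu> _ \<nu>] matrix_vector_mult_diff_distrib algebra_simps)
qed

lemma gauss_density_standard:
  "gauss_density 0 (mat 1) (x :: real^'n) = (\<Prod>b\<in>Basis. std_normal_density (x \<bullet> b))"
proof -
  have inv: "matrix_inv (mat 1 :: real^'n^'n) = mat 1" by (rule matrix_inv_eqI) simp
  have "(\<Prod>b\<in>(Basis :: (real^'n) set). 1 / sqrt (2 * pi)) = (1 / sqrt (2 * pi)) ^ CARD('n)"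
    by simp
  also have "\<dots> = 1 / sqrt ((2 * pi) ^ CARD('n))"
    by (simp only: power_one_over real_sqrt_power)
  finally have const: "(\<Prod>b\<in>(Basis :: (real^'n) set). 1 / sqrt (2 * pi)) = 1 / sqrt ((2 * pi) ^ CARD('n))" .
  have exp: "(\<Prod>b\<in>Basis. exp (- (x \<bullet> b)\<^sup>2 / 2)) = exp (- (1/2) * (x \<bullet> x))"
    by (subst exp_sum[symmetric]) (simp_all add: euclidean_inner[of x x] power2_eq_square sum_negf
      sum_divide_distrib[symmetric])
  show ?thesis
    by (simp only: std_normal_density_def prod.distrib const exp gauss_density_def inv det_I
        diff_zero matrix_vector_mul_lid) simp
qed

lemma distr_gauss_density_standard_nth:
  "distr (density lborel (\<lambda>x. ennreal (gauss_density 0 (mat 1 :: real^'n^'n) x))) borel (\<lambda>x. x $ k)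
     = density lborel (\<lambda>s. ennreal (std_normal_density s))"
proof (rule measure_eqI)
  let ?G = "density lborel (\<lambda>x. ennreal (gauss_density 0 (mat 1 :: real^'n^'n) x))"
  fix E assume "E \<in> sets (distr ?G borel (\<lambda>x. x $ k))"
  then have E [measurable]: "E \<in> sets borel" by simp
  have [measurable]: "(\<lambda>x :: real^'n. x $ k) \<in> borel_measurable borel"
    by (intro borel_measurable_continuous_onI continuous_intros)
  let ?f = "\<lambda>(b :: real^'n) s. ennreal (std_normal_density s) * (if b = axis k 1 then indicator E s else 1)"
  have k: "axis k 1 \<in> (Basis :: (real^'n) set)" by (simp add: axis_in_Basis_iff)
  have delta: "(\<Prod>b\<in>Basis. if b = axis k 1 then indicator E (x \<bullet> b) else (1 :: ennreal)) = indicator E (x $ k)"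
    for x :: "real^'n"
    using k by (subst prod.delta) (auto simp: cart_eq_inner_axis)
  have one: "(\<integral>\<^sup>+s. ennreal (std_normal_density s) \<partial>lborel) = 1"
    by (subst nn_integral_eq_integral) auto
  have "emeasure (distr ?G borel (\<lambda>x. x $ k)) E
      = (\<integral>\<^sup>+x. ennreal (gauss_density 0 (mat 1) x) * indicator E (x $ k) \<partial>lborel)"
    by (simp add: nn_integral_distr nn_integral_density flip: nn_integral_indicator)
  also have "\<dots> = (\<integral>\<^sup>+x. (\<Prod>b\<in>Basis. ?f b (x \<bullet> b)) \<partial>lborel)"
    by (simp only: gauss_density_standard prod.distrib delta) (simp add: prod_ennreal)
  also have "\<dots> = (\<Prod>b\<in>(Basis :: (real^'n) set). \<integral>\<^sup>+s. ?f b s \<partial>lborel)"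
    by (rule nn_integral_lborel_prod) auto
  also have "\<dots> = (\<Prod>b\<in>(Basis :: (real^'n) set). if b = axis k 1
      then \<integral>\<^sup>+s. ennreal (std_normal_density s) * indicator E s \<partial>lborel else 1)"
    by (intro prod.cong) (auto simp: one)
  also have "\<dots> = emeasure (density lborel (\<lambda>s. ennreal (std_normal_density s))) E"
    using k by (simp add: prod.delta emeasure_density)
  finally show "emeasure (distr ?G borel (\<lambda>x. x $ k)) E
      = emeasure (density lborel (\<lambda>s. ennreal (std_normal_density s))) E" .
qed simp

lemma distr_normal_density_affine:
  assumes "\<alpha> \<noteq> 0" "0 < \<sigma>"
  shows "distr (density lborel (\<lambda>s. ennreal (normal_density \<mu> \<sigma> s))) borel (\<lambda>s. \<beta> + \<alpha> * s)
    = density lborel (\<lambda>s. ennreal (normal_density (\<beta> + \<alpha> * \<mu>) (\<bar>\<alpha>\<bar> * \<sigma>) s))"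
proof -
  let ?N = "density lborel (\<lambda>s. ennreal (normal_density \<mu> \<sigma> s))"
  interpret prob_space ?N using assms by (intro prob_space_normal_density) auto
  have "distributed ?N lborel (\<lambda>s. s) (normal_density \<mu> \<sigma>)"
    by (auto simp: distributed_def distr_id2)
  from normal_density_affine[OF this assms(2,1), of \<beta>]
  have "distr ?N lborel (\<lambda>s. \<beta> + s * \<alpha>) = density lborel (\<lambda>s. ennreal (normal_density (\<beta> + \<mu> * \<alpha>) (\<bar>\<alpha>\<bar> * \<sigma>) s))"
    by (simp add: distributed_def mult.commute)
  then show ?thesis
    by (simp add: mult.commute cong: distr_cong)
qed

text \<open>The Gaussian is the image of the standard one under \<open>z \<mapsto> \<mu> + L z\<close>, where \<open>L\<close> is the square root of
\<open>S\<close> adapted to \<open>\<theta>\<close>. The projection then depends on one coordinate of \<open>z\<close> only, and the law of that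
coordinate is obtained from the product form of the standard Gaussian density.\<close>

lemma projected_law_gauss:
  fixes S :: "real^'n^'n"
  assumes S: "pos_def S" and \<theta>: "\<theta> \<noteq> 0"
  shows "projected_law \<theta> (gauss_density \<mu> S)
    = density lborel (\<lambda>s. ennreal (normal_density (\<theta> \<bullet> \<mu>) (sqrt (\<theta> \<bullet> (S *v \<theta>))) s))"
proof -
  \<comment> \<open>Any coordinate serves.\<close>
  define k :: 'n where "k = undefined"
  define c where "c = sqrt (\<theta> \<bullet> (S *v \<theta>))"
  have c: "0 < c" using S \<theta> by (simp add: c_def pos_def_def)
  obtain L :: "real^'n^'n" where L: "invertible L" "L ** transpose L = S" "transpose L *v \<theta> = c *\<^sub>R axis k 1"
    unfolding c_def by (rule pos_def_factorization[OF S \<theta>])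
  have proj: "\<theta> \<bullet> (\<mu> + L *v x) = \<theta> \<bullet> \<mu> + c * x $ k" for x
    using L(3) by (simp add: inner_add_right dot_lmul_matrix[symmetric] inner_axis')
  let ?G = "\<lambda>\<mu> S. density lborel (\<lambda>x :: real^'n. ennreal (gauss_density \<mu> S x))"
  have [measurable]: "(\<lambda>x. \<theta> \<bullet> x) \<in> borel_measurable borel" "(\<lambda>x. \<mu> + L *v (x - 0)) \<in> borel_measurable borel"
     "(\<lambda>x :: real^'n. x $ k) \<in> borel_measurable borel"
    by (intro borel_measurable_continuous_onI continuous_intros linear_continuous_on
        bounded_linear_compose[OF matrix_vector_mul_bounded_linear], simp)+
  have "projected_law \<theta> (gauss_density \<mu> S) = distr (distr (?G 0 (mat 1)) borel (\<lambda>x. \<mu> + L *v (x - 0))) borel (\<lambda>x. \<theta> \<bullet> x)"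
    using distr_gauss_density_affine[OF L(1) pos_def_mat_1, of 0 \<mu>] L(2)
    by (simp add: projected_law_def)
  also have "\<dots> = distr (?G 0 (mat 1)) borel (\<lambda>x. \<theta> \<bullet> \<mu> + c * x $ k)"
    by (subst distr_distr) (auto simp: o_def proj)
  also have "\<dots> = distr (distr (?G 0 (mat 1)) borel (\<lambda>x. x $ k)) borel (\<lambda>s. \<theta> \<bullet> \<mu> + c * s)"
    by (subst distr_distr) (auto simp: o_def)
  also have "\<dots> = density lborel (\<lambda>s. ennreal (normal_density (\<theta> \<bullet> \<mu>) c s))"
    using distr_normal_density_affine[of c 1 0 "\<theta> \<bullet> \<mu>"] c
    by (simp add: distr_gauss_density_standard_nth)
  finally show ?thesis by (simp add: c_def)
qed

section \<open>Optimal transport between normal laws\<close>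

text \<open>Weak Kantorovich duality. A pair of potentials below the cost bounds the cost of every coupling from
below by \<open>\<integral>\<phi> d\<mu> + \<integral>\<psi> d\<nu>\<close>. Equality on the graph of \<open>T\<close> says that the coupling carried by this graph
attains the bound.\<close>

lemma optimal_transport_map_by_duality:
  fixes \<mu> \<nu> :: "real measure"
  assumes sets: "sets \<mu> = sets borel" "sets \<nu> = sets borel"
    and T: "mono T" "T \<in> borel_measurable borel" "distr \<mu> borel T = \<nu>"
    and \<phi>: "integrable \<mu> \<phi>" and \<psi>: "integrable \<nu> \<psi>"
    and le: "\<And>s t. \<phi> s + \<psi> t \<le> (s - t)\<^sup>2"
    and eq: "\<And>s. \<phi> s + \<psi> (T s) = (s - T s)\<^sup>2"
  shows "optimal_transport_map \<mu> \<nu> T"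
proof -
  note [measurable_cong] = sets
  note [measurable] = T(2)
  have \<phi>m [measurable]: "\<phi> \<in> borel_measurable borel" and \<psi>m [measurable]: "\<psi> \<in> borel_measurable borel"
    using borel_measurable_integrable[OF \<phi>] borel_measurable_integrable[OF \<psi>] by measurable
  have \<psi>T: "integrable \<mu> (\<lambda>s. \<psi> (T s))"
    using \<psi> T(3) by (subst integrable_distr_eq[symmetric, where g=T and N=borel]) auto
  have int: "integrable \<mu> (\<lambda>s. (s - T s)\<^sup>2)"
    using Bochner_Integration.integrable_add[OF \<phi> \<psi>T] by (simp add: eq)
  define C where "C = (\<integral>s. (s - T s)\<^sup>2 \<partial>\<mu>)"
  have C0: "0 \<le> C" by (simp add: C_def)
  have "(\<integral>s. \<psi> (T s) \<partial>\<mu>) = (\<integral>t. \<psi> t \<partial>\<nu>)"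
    using T(3) by (subst integral_distr[symmetric, where N=borel]) auto
  then have C: "C = (\<integral>s. \<phi> s \<partial>\<mu>) + (\<integral>t. \<psi> t \<partial>\<nu>)"
    unfolding C_def by (simp add: eq[symmetric] Bochner_Integration.integral_add[OF \<phi> \<psi>T])
  let ?cost = "\<lambda>\<gamma>. \<integral>\<^sup>+z. ennreal ((dist (fst z) (snd z))\<^sup>2) \<partial>\<gamma>"
  have "(INF \<gamma>\<in>couplings \<mu> \<nu>. ?cost \<gamma>) = ennreal C"
  proof (rule antisym)
    let ?\<gamma> = "distr \<mu> (\<mu> \<Otimes>\<^sub>M \<nu>) (\<lambda>s. (s, T s))"
    have "distr \<mu> \<nu> T = \<nu>"
      using T(3) by (simp cong: distr_cong add: sets)
    then have "?\<gamma> \<in> couplings \<mu> \<nu>"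
      by (simp add: couplings_def distr_distr o_def distr_id2 sets)
    then have "(INF \<gamma>\<in>couplings \<mu> \<nu>. ?cost \<gamma>) \<le> ?cost ?\<gamma>" by (rule INF_lower)
    also have "\<dots> = (\<integral>\<^sup>+s. ennreal ((s - T s)\<^sup>2) \<partial>\<mu>)"
      by (subst nn_integral_distr) (auto simp: dist_real_def)
    also have "\<dots> = ennreal C"
      unfolding C_def by (rule nn_integral_eq_integral[OF int]) simp
    finally show "(INF \<gamma>\<in>couplings \<mu> \<nu>. ?cost \<gamma>) \<le> ennreal C" .
    show "ennreal C \<le> (INF \<gamma>\<in>couplings \<mu> \<nu>. ?cost \<gamma>)"
    proof (rule INF_greatest)
      fix \<gamma> assume "\<gamma> \<in> couplings \<mu> \<nu>"
      then have \<gamma>: "sets \<gamma> = sets (\<mu> \<Otimes>\<^sub>M \<nu>)" "distr \<gamma> \<mu> fst = \<mu>" "distr \<gamma> \<nu> snd = \<nu>"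
        by (simp_all add: couplings_def)
      note [measurable_cong] = \<gamma>(1)
      show "ennreal C \<le> ?cost \<gamma>"
      proof (cases "?cost \<gamma> = \<infinity>")
        case False
        have cost: "integrable \<gamma> (\<lambda>z. (dist (fst z) (snd z))\<^sup>2)"
          by (rule integrableI_nonneg) (use False in \<open>auto simp: less_top\<close>)
        have i1: "integrable \<gamma> (\<lambda>z. \<phi> (fst z))" "(\<integral>z. \<phi> (fst z) \<partial>\<gamma>) = (\<integral>s. \<phi> s \<partial>\<mu>)"
          using \<phi> \<gamma>(2) integrable_distr_eq[of fst \<gamma> \<mu> \<phi>] integral_distr[of fst \<gamma> \<mu> \<phi>] by simp_all
        have i2: "integrable \<gamma> (\<lambda>z. \<psi> (snd z))" "(\<integral>z. \<psi> (snd z) \<partial>\<gamma>) = (\<integral>t. \<psi> t \<partial>\<nu>)"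
          using \<psi> \<gamma>(3) integrable_distr_eq[of snd \<gamma> \<nu> \<psi>] integral_distr[of snd \<gamma> \<nu> \<psi>] by simp_all
        have "C = (\<integral>z. \<phi> (fst z) + \<psi> (snd z) \<partial>\<gamma>)"
          by (simp add: C i1 i2)
        also have "\<dots> \<le> (\<integral>z. (dist (fst z) (snd z))\<^sup>2 \<partial>\<gamma>)"
          by (rule integral_mono) (use i1 i2 cost le in \<open>auto simp: dist_real_def\<close>)
        finally have "ennreal C \<le> ennreal (\<integral>z. (dist (fst z) (snd z))\<^sup>2 \<partial>\<gamma>)" by (rule ennreal_leI)
        also have "\<dots> = ?cost \<gamma>"
          by (rule nn_integral_eq_integral[OF cost, symmetric]) simp
        finally show ?thesis .
      qed simp
    qed
  qed
  then have "(wasserstein2 \<mu> \<nu>)\<^sup>2 = C"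
    using C0 by (simp add: wasserstein2_def)
  then show ?thesis
    using T int by (simp add: optimal_transport_map_def C_def measurable_cong_sets[OF sets] cong: distr_cong add: sets)
qed

text \<open>With \<open>\<alpha> = \<tau> / \<sigma>\<close>, \<open>u = s - a\<close> and \<open>w = t - b\<close>, the only term of \<open>(s - t)\<^sup>2\<close> that is not a sum of a
function of \<open>s\<close> and a function of \<open>t\<close> is \<open>- 2 u w\<close>. It is at least \<open>- \<alpha> u\<^sup>2 - w\<^sup>2 / \<alpha>\<close>, with equality
if and only if \<open>w = \<alpha> u\<close>, which is the graph of the map. The resulting potentials are quadratic,
so they are integrable for normal laws.\<close>

lemma optimal_transport_map_normal:
  assumes \<sigma>: "0 < \<sigma>" and \<tau>: "0 < \<tau>"
    and push: "distr (density lborel (\<lambda>s. ennreal (normal_density a \<sigma> s))) borel (\<lambda>s. b + \<tau> / \<sigma> * (s - a))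
      = density lborel (\<lambda>s. ennreal (normal_density b \<tau> s))"
  shows "optimal_transport_map (density lborel (\<lambda>s. ennreal (normal_density a \<sigma> s)))
    (density lborel (\<lambda>s. ennreal (normal_density b \<tau> s))) (\<lambda>s. b + \<tau> / \<sigma> * (s - a))"
proof -
  define \<alpha> where "\<alpha> = \<tau> / \<sigma>"
  have \<alpha>: "0 < \<alpha>" using \<sigma> \<tau> by (simp add: \<alpha>_def)
  have quad: "integrable (density lborel (\<lambda>s. ennreal (normal_density c \<rho> s)))
      (\<lambda>s. p * (s - c)\<^sup>2 + q * (s - c) + r)" if "0 < \<rho>" for c \<rho> p q r :: real
  proof -
    have "integrable lborel (\<lambda>s. p * (normal_density c \<rho> s * (s - c)\<^sup>2)
        + q * (normal_density c \<rho> s * (s - c) ^ 1) + r * normal_density c \<rho> s)"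
      using that by (intro Bochner_Integration.integrable_add integrable_mult_right integrable_normal_moment
        integrable_normal_density) 
    then show ?thesis by (simp add: integrable_density algebra_simps)
  qed
  show ?thesis
    unfolding \<alpha>_def[symmetric]
  proof (rule optimal_transport_map_by_duality[where
        \<phi> = "\<lambda>s. (1 - \<alpha>) * (s - a)\<^sup>2 + 2 * (a - b) * (s - a) + (a - b)\<^sup>2" and
        \<psi> = "\<lambda>t. (1 - 1 / \<alpha>) * (t - b)\<^sup>2 + (- 2 * (a - b)) * (t - b) + 0"])
    fix s t
    have "0 \<le> (\<alpha> * (s - a) - (t - b))\<^sup>2 / \<alpha>" using \<alpha> by simp
    also have "\<dots> = (s - t)\<^sup>2 - ((1 - \<alpha>) * (s - a)\<^sup>2 + 2 * (a - b) * (s - a) + (a - b)\<^sup>2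
        + ((1 - 1 / \<alpha>) * (t - b)\<^sup>2 + (- 2 * (a - b)) * (t - b) + 0))"
      using \<alpha> by (simp add: field_simps power2_eq_square)
    finally show "(1 - \<alpha>) * (s - a)\<^sup>2 + 2 * (a - b) * (s - a) + (a - b)\<^sup>2
        + ((1 - 1 / \<alpha>) * (t - b)\<^sup>2 + (- 2 * (a - b)) * (t - b) + 0) \<le> (s - t)\<^sup>2" by simp
  next
    fix s
    show "(1 - \<alpha>) * (s - a)\<^sup>2 + 2 * (a - b) * (s - a) + (a - b)\<^sup>2
        + ((1 - 1 / \<alpha>) * (b + \<alpha> * (s - a) - b)\<^sup>2 + (- 2 * (a - b)) * (b + \<alpha> * (s - a) - b) + 0)
       = (s - (b + \<alpha> * (s - a)))\<^sup>2"
      using \<alpha> by (simp add: field_simps power2_eq_square)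
  next
    show "mono (\<lambda>s. b + \<alpha> * (s - a))" using \<alpha> by (intro monoI) simp
  next
    show "distr (density lborel (\<lambda>s. ennreal (normal_density a \<sigma> s))) borel (\<lambda>s. b + \<alpha> * (s - a))
      = density lborel (\<lambda>s. ennreal (normal_density b \<tau> s))"
      by (rule push[folded \<alpha>_def])
  qed (rule quad[OF \<sigma>] quad[OF \<tau>] | simp)+
qed

section \<open>Averages over the sphere\<close>

lemmas continuous_on_matrix_vector_mult [continuous_intros] =
  bounded_bilinear.continuous_on[OF bounded_bilinear_matrix_vector_mult]

lemma integrable_sphere_measure:
  fixes f :: "real^'n \<Rightarrow> 'b::{banach, second_countable_topology}"
  assumes "f \<in> borel_measurable borel" and "\<And>\<theta>. \<theta> \<in> sphere 0 1 \<Longrightarrow> norm (f \<theta>) \<le> B"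
  shows "integrable sphere_measure f"
proof -
  interpret prob_space "sphere_measure :: (real^'n) measure" by (rule prob_space_sphere_measure)
  have "AE \<theta> in sphere_measure. norm (f \<theta>) \<le> B"
    using AE_sphere_measure by eventually_elim (rule assms(2))
  then show ?thesis
    by (rule integrable_const_bound) (use assms(1) in measurable)
qed

lemma integrable_sphere_measure_continuous:
  fixes f :: "real^'n \<Rightarrow> 'b::{banach, second_countable_topology}"
  assumes "f \<in> borel_measurable borel" and "continuous_on (sphere 0 1) f"
  shows "integrable sphere_measure f"
proof -
  have "bounded (f ` sphere 0 1)"
    by (intro compact_imp_bounded compact_continuous_image assms(2)) simp
  then obtain B where "\<And>\<theta>. \<theta> \<in> sphere 0 1 \<Longrightarrow> norm (f \<theta>) \<le> B"
    unfolding bounded_iff by blast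
  with assms(1) show ?thesis by (rule integrable_sphere_measure)
qed

lemma integral_sphere_measure_orthogonal:
  fixes f :: "real^'n \<Rightarrow> real^'n" and g :: "real^'n \<Rightarrow> real"
  assumes f: "orthogonal_transformation f" and [measurable]: "g \<in> borel_measurable borel"
  shows "(\<integral>\<theta>. g (f \<theta>) \<partial>sphere_measure) = (\<integral>\<theta>. g \<theta> \<partial>sphere_measure)"
proof -
  have [measurable]: "f \<in> borel_measurable borel"
    using orthogonal_transformation_linear[OF f]
    by (intro borel_measurable_continuous_onI linear_continuous_on)
      (auto simp: linear_conv_bounded_linear)
  have "(\<integral>\<theta>. g \<theta> \<partial>sphere_measure) = (\<integral>\<theta>. g \<theta> \<partial>distr sphere_measure borel f)"
    by (simp add: sphere_measure_rotation_invariant[OF f])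
  also have "\<dots> = (\<integral>\<theta>. g (f \<theta>) \<partial>sphere_measure)"
    by (rule integral_distr) auto
  finally show ?thesis by simp
qed

lemma borel_measurable_component [measurable]: "(\<lambda>x :: real^'n. x $ i) \<in> borel_measurable borel"
  by (intro borel_measurable_continuous_onI continuous_intros)

text \<open>Reversing the sign of one coordinate annihilates the mixed moments, and exchanging two coordinates
makes the pure ones equal. They add up to 1, since the sum of the squared coordinates is 1 on the
sphere.\<close>

lemma sphere_second_moment:
  "(\<integral>\<theta>. \<theta> $ i * \<theta> $ j \<partial>(sphere_measure :: (real^'n) measure)) = (if i = j then 1 / real CARD('n) else 0)"
proof (cases "i = j")
  case False
  let ?f = "\<lambda>x :: real^'n. \<chi> k. if k = i then - x $ k else x $ k"
  have "linear ?f" by (intro linearI) (simp_all add: vec_eq_iff)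
  moreover have "?f x \<bullet> ?f y = x \<bullet> y" for x y
    unfolding inner_vec_def by (intro sum.cong) simp_all
  ultimately have "orthogonal_transformation ?f" by (simp add: orthogonal_transformation_def)
  from integral_sphere_measure_orthogonal[OF this, of "\<lambda>\<theta>. \<theta> $ i * \<theta> $ j"] False
  show ?thesis by simp
next
  case True
  let ?I = "\<lambda>i. \<integral>\<theta>. \<theta> $ i * \<theta> $ i \<partial>(sphere_measure :: (real^'n) measure)"
  have swap: "?I k = ?I i" for k
  proof -
    let ?f = "\<lambda>x :: real^'n. \<chi> l. x $ Transposition.transpose i k l"
    have "(\<Sum>l\<in>UNIV. x $ Transposition.transpose i k l * y $ Transposition.transpose i k l)
        = (\<Sum>l\<in>UNIV. x $ l * y $ l)" for x y :: "real^'n"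
      by (rule sum.reindex_bij_betw[of "Transposition.transpose i k" UNIV UNIV "\<lambda>l. x $ l * y $ l"]) simp
    then have "?f x \<bullet> ?f y = x \<bullet> y" for x y by (simp add: inner_vec_def)
    moreover have "linear ?f" by (intro linearI) (simp_all add: vec_eq_iff)
    ultimately have "orthogonal_transformation ?f" by (simp add: orthogonal_transformation_def)
    from integral_sphere_measure_orthogonal[OF this, of "\<lambda>\<theta>. \<theta> $ i * \<theta> $ i"]
    show ?thesis by simp
  qed
  have int: "integrable sphere_measure (\<lambda>\<theta> :: real^'n. \<theta> $ k * \<theta> $ k)" for k
    by (rule integrable_sphere_measure_continuous) (auto intro!: continuous_intros)
  interpret prob_space "sphere_measure :: (real^'n) measure" by (rule prob_space_sphere_measure)
  have "(\<Sum>k\<in>UNIV. ?I k) = (\<Sum>k\<in>(UNIV :: 'n set). ?I i)" by (rule sum.cong[OF refl swap])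
  then have "real CARD('n) * ?I i = (\<Sum>k\<in>UNIV. ?I k)" by simp
  also have "\<dots> = (\<integral>\<theta>. (\<Sum>k\<in>UNIV. \<theta> $ k * \<theta> $ k) \<partial>(sphere_measure :: (real^'n) measure))"
    using int by simp
  also have "\<dots> = (\<integral>\<theta>. 1 \<partial>(sphere_measure :: (real^'n) measure))"
  proof (rule integral_cong_AE)
    have "(\<Sum>k\<in>UNIV. \<theta> $ k * \<theta> $ k) = 1" if "\<theta> \<in> sphere 0 1" for \<theta> :: "real^'n"
    proof -
      have "(\<Sum>k\<in>UNIV. \<theta> $ k * \<theta> $ k) = \<theta> \<bullet> \<theta>" by (simp add: inner_vec_def)
      also have "\<dots> = 1" using that by (simp add: dot_square_norm)
      finally show ?thesis .
    qed
    then show "AE \<theta> in (sphere_measure :: (real^'n) measure). (\<Sum>k\<in>UNIV. \<theta> $ k * \<theta> $ k) = 1"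
      using AE_sphere_measure by (auto elim: AE_mp)
  qed auto
  also have "\<dots> = 1" using prob_space by simp
  finally show ?thesis using True by (simp add: field_simps)
qed

lemma bounded_linear_mult_vec: "bounded_linear (\<lambda>A :: real^'n^'m. A *v z)"
  by (rule bounded_bilinear.bounded_linear_left[OF bounded_bilinear_matrix_vector_mult])

lemma outer_mult_vec: "outer u w *v z = (w \<bullet> z) *\<^sub>R u"
  by (simp add: outer_def matrix_vector_mult_def vec_eq_iff inner_vec_def sum_distrib_left mult_ac)

lemma continuous_on_outer_self: "continuous_on X (\<lambda>\<theta> :: real^'n. outer \<theta> \<theta>)"
  unfolding outer_def by (intro continuous_intros)

lemma measurable_outer_self [measurable]: "(\<lambda>\<theta> :: real^'n. outer \<theta> \<theta>) \<in> borel_measurable borel"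
  by (intro borel_measurable_continuous_onI continuous_on_outer_self)

lemma measurable_quadratic_form [measurable]:
  "(\<lambda>\<theta> :: real^'n. \<theta> \<bullet> (S *v \<theta>)) \<in> borel_measurable borel"
  by (intro borel_measurable_continuous_onI continuous_intros)

lemma integral_sphere_inner:
  "(\<integral>\<theta>. (\<theta> \<bullet> z) *\<^sub>R \<theta> \<partial>sphere_measure) = (1 / real CARD('n)) *\<^sub>R (z :: real^'n)"
proof -
  have int: "integrable sphere_measure (\<lambda>\<theta> :: real^'n. outer \<theta> \<theta>)"
    by (rule integrable_sphere_measure_continuous) (auto intro: continuous_on_outer_self)
  have "(\<integral>\<theta>. outer \<theta> \<theta> \<partial>sphere_measure) $ i $ j = (\<integral>\<theta>. \<theta> $ i * \<theta> $ j \<partial>(sphere_measure :: (real^'n) measure))" for i j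
    using integral_bounded_linear[OF bounded_linear_compose[OF bounded_linear_vec_nth[of j] bounded_linear_vec_nth[of i]] int]
    by (simp add: outer_def)
  then have "(\<integral>\<theta>. outer \<theta> \<theta> \<partial>sphere_measure) = ((1 / real CARD('n)) *\<^sub>R mat 1 :: real^'n^'n)"
    by (simp add: vec_eq_iff sphere_second_moment mat_def)
  then have "(\<integral>\<theta>. outer \<theta> \<theta> *v z \<partial>sphere_measure) = (1 / real CARD('n)) *\<^sub>R z"
    using integral_bounded_linear[OF bounded_linear_mult_vec int, of z]
    by (simp add: scaleR_matrix_vector_assoc[symmetric])
  then show ?thesis by (simp add: outer_mult_vec)
qed

lemma pos_def_unit_vector:
  assumes "pos_def S" "norm \<theta> = 1"
  shows "0 < \<theta> \<bullet> (S *v \<theta>)"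
  using assms by (metis norm_zero pos_def_def zero_neq_one)

lemma continuous_on_sphere_ratio:
  assumes "continuous_on X S" and "\<And>t. t \<in> X \<Longrightarrow> pos_def (S t)"
  shows "continuous_on (X \<times> sphere 0 1) (\<lambda>(t, \<theta> :: real^'n). sqrt ((\<theta> \<bullet> (Sf *v \<theta>)) / (\<theta> \<bullet> (S t *v \<theta>))))"
proof -
  have "\<theta> \<bullet> (S t *v \<theta>) \<noteq> 0" if "t \<in> X" "norm \<theta> = 1" for t \<theta>
    using pos_def_unit_vector[OF assms(2)[OF that(1)] that(2)] by simp
  then show ?thesis
    unfolding split_beta
    by (auto intro!: continuous_intros continuous_on_compose2[OF assms(1) continuous_on_fst])
qed

lemma continuous_on_sphere_integrand:
  assumes "pos_def (S :: real^'n^'n)"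
  shows "continuous_on (sphere 0 1) (\<lambda>\<theta> :: real^'n. sqrt ((\<theta> \<bullet> (Sf *v \<theta>)) / (\<theta> \<bullet> (S *v \<theta>))))"
proof -
  have "\<theta> \<bullet> (S *v \<theta>) \<noteq> 0" if "norm \<theta> = 1" for \<theta>
    using pos_def_unit_vector[OF assms that] by simp
  then show ?thesis by (auto intro!: continuous_intros)
qed

lemma sphere_matrix_mult_vec:
  assumes S: "pos_def (S :: real^'n^'n)"
  shows "integrable sphere_measure (\<lambda>\<theta>. (sqrt ((\<theta> \<bullet> (Sf *v \<theta>)) / (\<theta> \<bullet> (S *v \<theta>))) * (\<theta> \<bullet> z)) *\<^sub>R \<theta>)"
    and "sphere_matrix Sf S *v z =
      (\<integral>\<theta>. (sqrt ((\<theta> \<bullet> (Sf *v \<theta>)) / (\<theta> \<bullet> (S *v \<theta>))) * (\<theta> \<bullet> z)) *\<^sub>R \<theta> \<partial>sphere_measure)"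
proof -
  show "integrable sphere_measure (\<lambda>\<theta>. (sqrt ((\<theta> \<bullet> (Sf *v \<theta>)) / (\<theta> \<bullet> (S *v \<theta>))) * (\<theta> \<bullet> z)) *\<^sub>R \<theta>)"
    by (rule integrable_sphere_measure_continuous)
      (auto intro!: continuous_intros continuous_on_sphere_integrand S)
  have int: "integrable sphere_measure
      (\<lambda>\<theta>. sqrt ((\<theta> \<bullet> (Sf *v \<theta>)) / (\<theta> \<bullet> (S *v \<theta>))) *\<^sub>R outer \<theta> \<theta>)"
    by (rule integrable_sphere_measure_continuous)
      (auto intro!: continuous_intros continuous_on_sphere_integrand continuous_on_outer_self S)
  show "sphere_matrix Sf S *v z =
      (\<integral>\<theta>. (sqrt ((\<theta> \<bullet> (Sf *v \<theta>)) / (\<theta> \<bullet> (S *v \<theta>))) * (\<theta> \<bullet> z)) *\<^sub>R \<theta> \<partial>sphere_measure)"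
    using integral_bounded_linear[OF bounded_linear_mult_vec int, of z]
    by (simp add: sphere_matrix_def scaleR_matrix_vector_assoc[symmetric] outer_mult_vec)
qed

text \<open>For \<open>t\<close> in a compact set and \<open>\<theta>\<close> on the sphere the integrand is jointly continuous and hence
bounded, so dominated convergence applies.\<close>

lemma continuous_on_sphere_matrix:
  fixes S :: "real \<Rightarrow> real^'n^'n"
  assumes X: "compact X" and S: "continuous_on X S" "\<And>t. t \<in> X \<Longrightarrow> pos_def (S t)"
  shows "continuous_on X (\<lambda>t. sphere_matrix Sf (S t))"
proof -
  let ?g = "\<lambda>t (\<theta> :: real^'n). sqrt ((\<theta> \<bullet> (Sf *v \<theta>)) / (\<theta> \<bullet> (S t *v \<theta>))) *\<^sub>R outer \<theta> \<theta>"
  have cont: "continuous_on (X \<times> sphere 0 1) (\<lambda>(t, \<theta>). ?g t \<theta>)"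
    using continuous_on_scaleR[OF continuous_on_sphere_ratio[OF S, of Sf]
        continuous_on_compose2[OF continuous_on_outer_self continuous_on_snd[OF continuous_on_id] subset_UNIV]]
    by (simp add: split_beta)
  then have "bounded ((\<lambda>(t, \<theta>). ?g t \<theta>) ` (X \<times> sphere 0 1))"
    by (intro compact_imp_bounded compact_continuous_image compact_Times X) auto
  then obtain B where B: "\<And>t \<theta>. t \<in> X \<Longrightarrow> \<theta> \<in> sphere 0 1 \<Longrightarrow> norm (?g t \<theta>) \<le> B"
    unfolding bounded_iff by fastforce
  interpret prob_space "sphere_measure :: (real^'n) measure" by (rule prob_space_sphere_measure)
  show ?thesis
    unfolding continuous_on_sequentially
  proof (intro allI ballI impI)
    fix u a assume a: "a \<in> X" and u: "(\<forall>n. u n \<in> X) \<and> u \<longlonglongrightarrow> a"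
    have lim: "(\<lambda>n. ?g (u n) \<theta>) \<longlonglongrightarrow> ?g a \<theta>" if \<theta>: "\<theta> \<in> sphere 0 1" for \<theta>
    proof -
      have "(\<lambda>n. (u n, \<theta>)) \<longlonglongrightarrow> (a, \<theta>)" using u by (intro tendsto_Pair) auto
      from continuous_on_tendsto_compose[OF cont this] show ?thesis using a u \<theta> by simp
    qed
    have "(\<lambda>n. sphere_matrix Sf (S (u n))) \<longlonglongrightarrow> sphere_matrix Sf (S a)"
      unfolding sphere_matrix_def
    proof (rule integral_dominated_convergence[where w="\<lambda>_. B"])
      show "AE \<theta> in sphere_measure. (\<lambda>n. ?g (u n) \<theta>) \<longlonglongrightarrow> ?g a \<theta>"
        using AE_sphere_measure by eventually_elim (rule lim)
      show "AE \<theta> in sphere_measure. norm (?g (u n) \<theta>) \<le> B" for n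
        using AE_sphere_measure by eventually_elim (use B u in auto)
    qed auto
    then show "((\<lambda>t. sphere_matrix Sf (S t)) \<circ> u) \<longlonglongrightarrow> sphere_matrix Sf (S a)"
      by (simp add: o_def)
  qed
qed

section \<open>Gaussian densities driven by an affine velocity field\<close>

text \<open>The transpose of the inverse of the fundamental matrix solves \<open>X' = - K\<^sup>T X\<close>. So \<open>\<Psi>\<close> is defined by this
equation. The products \<open>\<Psi> \<Phi>\<close> and \<open>\<Psi> S \<Psi>\<^sup>T\<close> then have derivative zero: the first identifies \<open>\<Psi>\<close> with
\<open>\<Phi>\<^sup>-\<^sup>1\<close>, and the second gives the formula for \<open>S\<close>.\<close>

lemma covariance_by_fundamental_matrix:
  fixes K S :: "real \<Rightarrow> real^'n^'n"
  assumes K: "continuous_on {0..<T} K"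
    and S: "\<And>t. t \<in> {0..<T} \<Longrightarrow>
      (S has_vector_derivative K t ** S t + S t ** transpose (K t)) (at t within {0..<T})"
  obtains \<Phi> \<Psi> where "\<Phi> 0 = mat 1"
    and "\<And>t. t \<in> {0..<T} \<Longrightarrow> (\<Phi> has_vector_derivative K t ** \<Phi> t) (at t within {0..<T})"
    and "\<And>t. t \<in> {0..<T} \<Longrightarrow> (\<Psi> has_vector_derivative - (\<Psi> t ** K t)) (at t within {0..<T})"
    and "\<And>t. t \<in> {0..<T} \<Longrightarrow> \<Psi> t ** \<Phi> t = mat 1"
    and "\<And>t. t \<in> {0..<T} \<Longrightarrow> S t = \<Phi> t ** S 0 ** transpose (\<Phi> t)"
proof -
  interpret mm: bounded_bilinear "(**) :: real^'n^'n \<Rightarrow> real^'n^'n \<Rightarrow> real^'n^'n"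
    by (rule bounded_bilinear_matrix_mult)
  have tr: "bounded_linear (transpose :: real^'n^'n \<Rightarrow> real^'n^'n)"
    by (rule bounded_linear_transpose)
  have tneg: "transpose (- X) = - transpose X" for X :: "real^'n^'n"
    by (simp add: transpose_def vec_eq_iff)
  obtain \<Phi> where \<Phi>: "\<Phi> 0 = mat 1"
    "\<And>t. t \<in> {0..<T} \<Longrightarrow> (\<Phi> has_vector_derivative K t ** \<Phi> t) (at t within {0..<T})"
    using fundamental_matrix_exists[OF K] by blast
  have "continuous_on {0..<T} (\<lambda>t. - transpose (K t))"
    by (intro continuous_intros bounded_linear.continuous_on[OF tr] K)
  then obtain X where X: "X 0 = mat 1"
    "\<And>t. t \<in> {0..<T} \<Longrightarrow> (X has_vector_derivative (- transpose (K t)) ** X t) (at t within {0..<T})"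
    using fundamental_matrix_exists by blast
  define \<Psi> where "\<Psi> t = transpose (X t)" for t
  have \<Psi>: "(\<Psi> has_vector_derivative - (\<Psi> t ** K t)) (at t within {0..<T})" if "t \<in> {0..<T}" for t
    using bounded_linear.has_vector_derivative[OF tr X(2)[OF that]]
    by (simp add: \<Psi>_def[abs_def] mm.minus_left tneg matrix_transpose_mul)
  have const: "f t = f 0" if f: "\<And>t. t \<in> {0..<T} \<Longrightarrow> (f has_vector_derivative 0) (at t within {0..<T})"
    and t: "t \<in> {0..<T}" for f :: "real \<Rightarrow> real^'n^'n" and t
    using has_derivative_zero_constant[of "{0..<T}" f] f t
    by (force simp: has_vector_derivative_def)
  have inv: "\<Psi> t ** \<Phi> t = mat 1" if t: "t \<in> {0..<T}" for t
  proof -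
    have "((\<lambda>t. \<Psi> t ** \<Phi> t) has_vector_derivative 0) (at t within {0..<T})" if t: "t \<in> {0..<T}" for t
      using mm.has_vector_derivative[OF \<Psi>[OF t] \<Phi>(2)[OF t]]
      by (simp add: mm.minus_left matrix_mul_assoc)
    from const[OF this t] show ?thesis by (simp add: \<Psi>_def X(1) \<Phi>(1))
  qed
  have "S t = \<Phi> t ** S 0 ** transpose (\<Phi> t)" if t: "t \<in> {0..<T}" for t
  proof -
    have "((\<lambda>t. \<Psi> t ** S t ** transpose (\<Psi> t)) has_vector_derivative 0) (at t within {0..<T})"
      if t: "t \<in> {0..<T}" for t
      using mm.has_vector_derivative[OF mm.has_vector_derivative[OF \<Psi>[OF t] S[OF t]]
          bounded_linear.has_vector_derivative[OF tr \<Psi>[OF t]]]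
      by (simp add: mm.minus_left mm.minus_right mm.add_left mm.add_right tneg matrix_transpose_mul
          matrix_mul_assoc)
    from const[OF this t] have eq: "\<Psi> t ** S t ** transpose (\<Psi> t) = S 0"
      by (simp add: \<Psi>_def X(1))
    have r: "\<Phi> t ** \<Psi> t = mat 1" using inv[OF t] matrix_left_right_inverse by blast
    then have r': "transpose (\<Psi> t) ** transpose (\<Phi> t) = mat 1"
      by (metis matrix_transpose_mul transpose_mat)
    have "\<Phi> t ** S 0 ** transpose (\<Phi> t) = (\<Phi> t ** \<Psi> t) ** S t ** (transpose (\<Psi> t) ** transpose (\<Phi> t))"
      by (simp only: eq[symmetric] matrix_mul_assoc)
    then show ?thesis by (simp add: r r')
  qed
  with \<Phi> \<Psi> inv show ?thesis by (rule that)
qed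

text \<open>Since \<open>S\<^sup>-\<^sup>1 = \<Psi>\<^sup>T S(0)\<^sup>-\<^sup>1 \<Psi>\<close>, the derivative of the inverse follows from the equation for \<open>\<Psi>\<close>.\<close>

lemma matrix_inv_covariance_derivative:
  fixes K S :: "real \<Rightarrow> real^'n^'n"
  assumes K: "continuous_on {0..<T} K"
    and S: "\<And>t. t \<in> {0..<T} \<Longrightarrow>
      (S has_vector_derivative K t ** S t + S t ** transpose (K t)) (at t within {0..<T})"
    and inv: "invertible (S 0)" and t: "t \<in> {0..<T}"
  shows "((\<lambda>t. matrix_inv (S t)) has_vector_derivative
      - (transpose (K t) ** matrix_inv (S t) + matrix_inv (S t) ** K t)) (at t within {0..<T})"
proof -
  interpret mm: bounded_bilinear "(**) :: real^'n^'n \<Rightarrow> real^'n^'n \<Rightarrow> real^'n^'n"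
    by (rule bounded_bilinear_matrix_mult)
  obtain \<Phi> \<Psi> where \<Psi>: "\<And>t. t \<in> {0..<T} \<Longrightarrow> (\<Psi> has_vector_derivative - (\<Psi> t ** K t)) (at t within {0..<T})"
    and \<Psi>\<Phi>: "\<And>t. t \<in> {0..<T} \<Longrightarrow> \<Psi> t ** \<Phi> t = mat 1"
    and S\<Phi>: "\<And>t. t \<in> {0..<T} \<Longrightarrow> S t = \<Phi> t ** S 0 ** transpose (\<Phi> t)"
    using covariance_by_fundamental_matrix[OF K S] by metis
  obtain P0 where P0: "S 0 ** P0 = mat 1" using inv unfolding invertible_def by blast
  let ?P = "\<lambda>t. transpose (\<Psi> t) ** P0 ** \<Psi> t"
  have P: "matrix_inv (S s) = ?P s" if s: "s \<in> {0..<T}" for s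
  proof (rule matrix_inv_eqI)
    have r: "\<Phi> s ** \<Psi> s = mat 1" using \<Psi>\<Phi>[OF s] matrix_left_right_inverse by blast
    have l: "transpose (\<Phi> s) ** transpose (\<Psi> s) = mat 1"
      using \<Psi>\<Phi>[OF s] by (metis matrix_transpose_mul transpose_mat)
    have "S s ** ?P s = \<Phi> s ** (S 0 ** (transpose (\<Phi> s) ** transpose (\<Psi> s)) ** P0) ** \<Psi> s"
      by (subst S\<Phi>[OF s]) (simp only: matrix_mul_assoc)
    then show "S s ** ?P s = mat 1" by (simp add: l P0 r)
  qed
  have tneg: "transpose (- X) = - transpose X" for X :: "real^'n^'n"
    by (simp add: transpose_def vec_eq_iff)
  have "(?P has_vector_derivative - (?P t ** K t + transpose (K t) ** ?P t)) (at t within {0..<T})"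
    using mm.has_vector_derivative[OF mm.has_vector_derivative[OF
        bounded_linear.has_vector_derivative[OF bounded_linear_transpose \<Psi>[OF t]]
        has_vector_derivative_const[of P0]] \<Psi>[OF t]]
    by (simp add: mm.minus_left mm.minus_right mm.add_left mm.add_right mm.zero_right mm.zero_left tneg matrix_transpose_mul
          matrix_mul_assoc)
  then show ?thesis
    unfolding P[OF t] by (subst add.commute) (rule has_vector_derivative_transform[OF t P])
qed

text \<open>Liouville's formula applies because the right-hand side equals \<open>(K + S K\<^sup>T S\<^sup>-\<^sup>1) S\<close>, and the two summands
in the bracket have the same trace.\<close>

lemma det_covariance_derivative:
  fixes K :: "real^'n^'n" and S :: "real \<Rightarrow> real^'n^'n"
  assumes S: "(S has_vector_derivative K ** S t + S t ** transpose K) (at t within X)"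
    and inv: "invertible (S t)"
  shows "((\<lambda>t. det (S t)) has_real_derivative 2 * trace K * det (S t)) (at t within X)"
proof -
  obtain P where P: "S t ** P = mat 1" "P ** S t = mat 1" using inv unfolding invertible_def by blast
  have "K ** S t + S t ** transpose K = (K + S t ** transpose K ** P) ** S t"
    by (simp add: bounded_bilinear.add_left[OF bounded_bilinear_matrix_mult]
        matrix_mul_assoc[symmetric] P)
  moreover have "trace (K + S t ** transpose K ** P) = 2 * trace K"
  proof -
    have "trace (S t ** transpose K ** P) = trace (P ** (S t ** transpose K))"
      by (rule trace_mul_sym)
    also have "\<dots> = trace K" by (simp add: matrix_mul_assoc P trace_def transpose_def)
    finally show ?thesis by (simp add: trace_add)
  qed
  ultimately show ?thesis using liouville_det_derivative[of S "K + S t ** transpose K ** P" t X] S by simp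
qed

text \<open>Put \<open>w = S\<^sup>-\<^sup>1 (x - m)\<close>. Both sides of the equation equal \<open>\<rho> (w \<bullet> v - trace K)\<close>. In time, the
exponent of the Gaussian contributes \<open>w \<bullet> v\<close> and the determinant contributes the trace. In space,
\<open>\<nabla>\<rho> = - \<rho> w\<close> and the divergence of \<open>v\<close> is \<open>trace K\<close>.\<close>

lemma gaussian_continuity_equation:
  fixes K S :: "real \<Rightarrow> real^'n^'n" and m m' :: "real \<Rightarrow> real^'n"
  assumes K: "continuous_on {0..<T} K"
    and S: "\<And>t. t \<in> {0..<T} \<Longrightarrow>
      (S has_vector_derivative K t ** S t + S t ** transpose (K t)) (at t within {0..<T})"
    and pos: "\<And>t. t \<in> {0..<T} \<Longrightarrow> pos_def (S t)"
    and m: "\<And>t. t \<in> {0..<T} \<Longrightarrow> (m has_vector_derivative m' t) (at t within {0..<T})"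
    and m': "continuous_on {0..<T} m'"
    and v: "\<And>t x. t \<in> {0..<T} \<Longrightarrow> v t x = K t *v (x - m t) + m' t"
    and T: "0 < T"
  shows "classical_continuity_equation T (gauss_density (m 0) (S 0)) v (\<lambda>t. gauss_density (m t) (S t))"
proof -
  let ?I = "{0..<T}"
  interpret mv: bounded_bilinear "(*v) :: real^'n^'n \<Rightarrow> real^'n \<Rightarrow> real^'n"
    by (rule bounded_bilinear_matrix_vector_mult)
  define P where "P t = matrix_inv (S t)" for t
  have invS: "invertible (S t)" if "t \<in> ?I" for t
    using pos_def_det[OF pos[OF that]] by (simp add: invertible_det_nz)
  have P: "(P has_vector_derivative - (transpose (K t) ** P t + P t ** K t)) (at t within ?I)"
    if "t \<in> ?I" for t
    unfolding P_def by (rule matrix_inv_covariance_derivative[OF K S invS that]) (use T in auto)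
  have det: "((\<lambda>t. det (S t)) has_real_derivative 2 * trace (K t) * det (S t)) (at t within ?I)"
    if "t \<in> ?I" for t
    by (rule det_covariance_derivative[OF S invS]) (use that in auto)
  have Psym: "transpose (P t) = P t" if t: "t \<in> ?I" for t
  proof -
    obtain Q where Q: "S t ** Q = mat 1" using invS[OF t] unfolding invertible_def by blast
    have "transpose Q ** S t = mat 1"
      using arg_cong[OF Q, of transpose] pos[OF t] by (simp add: matrix_transpose_mul pos_def_def)
    then have "S t ** transpose Q = mat 1" using matrix_left_right_inverse by blast
    with matrix_inv_eqI[OF Q] matrix_inv_eqI[OF this] show ?thesis by (simp add: P_def)
  qed
  have contm: "continuous_on ?I m" and contP: "continuous_on ?I P"
    and contdet: "continuous_on ?I (\<lambda>t. det (S t))"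
    unfolding continuous_on_eq_continuous_within
    using has_vector_derivative_continuous[OF m] has_vector_derivative_continuous[OF P]
      DERIV_continuous[OF det] by blast+
  note lift = continuous_on_compose2[OF _ continuous_on_fst[OF continuous_on_id]]
  note cont [continuous_intros] =
    lift[OF contm] lift[OF contP] lift[OF contdet] lift[OF K] lift[OF m']
  define \<rho> where "\<rho> t x = gauss_density (m t) (S t) x" for t x
  have \<rho>: "\<rho> t x = exp (- (1/2) * ((x - m t) \<bullet> (P t *v (x - m t)))) / sqrt ((2 * pi) ^ CARD('n) * det (S t))"
    for t x by (simp add: \<rho>_def gauss_density_def P_def)
  have detpos: "0 < (2 * pi) ^ CARD('n) * det (S t)" if "t \<in> ?I" for t
    using pos_def_det[OF pos[OF that]] by simp
  have cont\<rho>: "continuous_on (?I \<times> UNIV) (\<lambda>(t, x). \<rho> t x)"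
    unfolding split_beta \<rho>
    by (intro continuous_intros) (use detpos in force)+
  define \<rho>' where "\<rho>' t x = \<rho> t x * ((P t *v (x - m t)) \<bullet> (K t *v (x - m t) + m' t) - trace (K t))" for t x
  have cont\<rho>': "continuous_on (?I \<times> UNIV) (\<lambda>(t, x). \<rho>' t x)"
    unfolding split_beta \<rho>'_def trace_def
    by (intro continuous_intros cont\<rho>[unfolded split_beta]) auto
  have time: "((\<lambda>s. \<rho> s x) has_real_derivative \<rho>' t x) (at t within ?I)" if t: "t \<in> ?I" for t x
  proof -
    let ?y = "x - m t"
    have y: "((\<lambda>s. x - m s) has_vector_derivative - m' t) (at t within ?I)"
      using has_vector_derivative_diff[OF has_vector_derivative_const m[OF t]] by simp
    have sym: "u \<bullet> (P t *v w) = (P t *v u) \<bullet> w" for u w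
      by (metis Psym[OF t] dot_lmul_matrix transpose_matrix_vector)
    have "((\<lambda>s. (x - m s) \<bullet> (P s *v (x - m s))) has_vector_derivative
        ?y \<bullet> (P t *v (- m' t) + (- (transpose (K t) ** P t + P t ** K t)) *v ?y) + (- m' t) \<bullet> (P t *v ?y)) (at t within ?I)"
      by (rule bounded_bilinear.has_vector_derivative[OF bounded_bilinear_inner y mv.has_vector_derivative[OF P[OF t] y]])
    moreover have "?y \<bullet> (P t *v (- m' t) + (- (transpose (K t) ** P t + P t ** K t)) *v ?y) + (- m' t) \<bullet> (P t *v ?y)
       = - 2 * ((P t *v ?y) \<bullet> (K t *v ?y + m' t))"
    proof -
      have "?y \<bullet> ((transpose (K t) ** P t) *v ?y) = (P t *v ?y) \<bullet> (K t *v ?y)"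
        by (simp add: matrix_vector_mul_assoc[symmetric] dot_lmul_matrix inner_commute[of ?y])
      moreover have "?y \<bullet> ((P t ** K t) *v ?y) = (P t *v ?y) \<bullet> (K t *v ?y)"
        by (simp add: matrix_vector_mul_assoc[symmetric] sym)
      moreover have "?y \<bullet> (P t *v m' t) = (P t *v ?y) \<bullet> m' t" by (rule sym)
      ultimately show ?thesis
        by (simp add: mv.minus_left mv.minus_right mv.add_left mv.diff_left inner_add_right inner_diff_right inner_commute[of "m' t"])
    qed
    ultimately have q: "((\<lambda>s. (x - m s) \<bullet> (P s *v (x - m s))) has_real_derivative
        - 2 * ((P t *v ?y) \<bullet> (K t *v ?y + m' t))) (at t within ?I)"
      by (simp add: has_real_derivative_iff_has_vector_derivative)
    let ?d = "sqrt ((2 * pi) ^ CARD('n) * det (S t))"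
    have "0 < ?d" by (rule real_sqrt_gt_zero[OF detpos[OF t]])
    then have d: "?d \<noteq> 0" "?d * ?d = (2 * pi) ^ CARD('n) * det (S t)"
      using detpos[OF t] by (simp_all only: real_sqrt_mult_self abs_of_pos less_imp_neq[symmetric] not_False_eq_True)
    have r: "((\<lambda>s. sqrt ((2 * pi) ^ CARD('n) * det (S s))) has_real_derivative
        (inverse ?d / 2) * ((2 * pi) ^ CARD('n) * (2 * trace (K t) * det (S t)))) (at t within ?I)"
      by (rule DERIV_chain2[OF DERIV_real_sqrt[OF detpos[OF t]] DERIV_cmult[OF det[OF t]]])
    have "(inverse ?d / 2) * ((2 * pi) ^ CARD('n) * (2 * trace (K t) * det (S t)))
      = inverse ?d * (?d * ?d) * trace (K t)" unfolding d(2) by simp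
    also have "\<dots> = trace (K t) * ?d"
    proof -
      have "inverse d * (d * d) * k = k * d" if "d \<noteq> 0" for d k :: real using that by simp
      from this[OF d(1)] show ?thesis .
    qed
    finally have r: "((\<lambda>s. sqrt ((2 * pi) ^ CARD('n) * det (S s))) has_real_derivative trace (K t) * ?d) (at t within ?I)"
      using r by (simp only:)
    let ?a = "(P t *v ?y) \<bullet> (K t *v ?y + m' t)"
    let ?e = "exp (- (1/2) * (?y \<bullet> (P t *v ?y)))"
    have e: "((\<lambda>s. exp (- (1/2) * ((x - m s) \<bullet> (P s *v (x - m s))))) has_real_derivative ?e * ?a) (at t within ?I)"
      using DERIV_chain2[OF DERIV_exp DERIV_cmult[OF q, of "- (1/2)"]] by simp
    have "((\<lambda>s. \<rho> s x) has_real_derivative (?e * ?a * ?d - ?e * (trace (K t) * ?d)) / (?d * ?d)) (at t within ?I)"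
      unfolding \<rho> by (rule DERIV_divide[OF e r d(1)])
    moreover have "(?e * ?a * ?d - ?e * (trace (K t) * ?d)) / (?d * ?d) = \<rho>' t x"
    proof -
      have "(e * a * d - e * (k * d)) / (d * d) = e / d * (a - k)" if "d \<noteq> 0" for e a d k :: real
        using that by (simp add: field_simps)
      from this[OF d(1)] show ?thesis unfolding \<rho>'_def \<rho> .
    qed
    ultimately show ?thesis by simp
  qed
  have space: "((\<lambda>y. \<rho> t y *\<^sub>R v t y) has_derivative
      (\<lambda>h. \<rho> t x *\<^sub>R (K t *v h) + (- \<rho> t x * ((P t *v (x - m t)) \<bullet> h)) *\<^sub>R v t x)) (at x)" if t: "t \<in> ?I" for t x
  proof -
    let ?y = "x - m t"
    have sym: "u \<bullet> (P t *v w) = (P t *v u) \<bullet> w" for u w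
      by (metis Psym[OF t] dot_lmul_matrix transpose_matrix_vector)
    have lin: "((\<lambda>z. A *v (z - m t)) has_derivative (\<lambda>h. A *v h)) (at x)" for A :: "real^'n^'n"
      using has_derivative_diff[OF has_derivative_ident has_derivative_const]
      by (intro bounded_linear.has_derivative[OF matrix_vector_mul_bounded_linear]) (auto intro!: derivative_eq_intros)
    have q: "((\<lambda>z. (z - m t) \<bullet> (P t *v (z - m t))) has_derivative (\<lambda>h. 2 * ((P t *v ?y) \<bullet> h))) (at x)"
    proof -
      have id: "((\<lambda>z. z - m t) has_derivative (\<lambda>h. h)) (at x)" by (auto intro!: derivative_eq_intros)
      show ?thesis
        using has_derivative_inner[OF id lin[of "P t"]]
        by (rule has_derivative_eq_rhs) (simp add: fun_eq_iff sym inner_commute)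
    qed
    have e: "((\<lambda>z. \<rho> t z) has_derivative (\<lambda>h. - \<rho> t x * ((P t *v ?y) \<bullet> h))) (at x)"
      unfolding \<rho> divide_inverse
      by (rule has_derivative_eq_rhs[OF has_derivative_mult_left[OF has_derivative_exp[OF has_derivative_mult_right[OF q]]]])
        (simp add: fun_eq_iff mult_ac)
    have "((\<lambda>z. v t z) has_derivative (\<lambda>h. K t *v h)) (at x)"
      unfolding v[OF t] using has_derivative_add[OF lin has_derivative_const] by simp
    from has_derivative_scaleR[OF e this] show ?thesis by simp
  qed
  have "classical_continuity_equation T (\<rho> 0) v \<rho>"
    unfolding classical_continuity_equation_def
  proof (intro conjI exI[of _ \<rho>'] ballI allI)
    fix t x assume t: "t \<in> ?I"
    show "(\<lambda>y. \<rho> t y *\<^sub>R v t y) differentiable (at x)"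
      using space[OF t] unfolding differentiable_def by blast
    let ?w = "P t *v (x - m t)"
    have "divergence (\<lambda>y. \<rho> t y *\<^sub>R v t y) x
        = (\<Sum>i\<in>UNIV. \<rho> t x * K t $ i $ i + - \<rho> t x * (?w $ i * v t x $ i))"
      unfolding divergence_def frechet_derivative_at[OF space[OF t], symmetric]
      by (intro sum.cong) (simp_all add: matrix_vector_mult_basis column_def inner_axis)
    also have "\<dots> = \<rho> t x * trace (K t) - \<rho> t x * (?w \<bullet> v t x)"
      by (simp add: sum_subtractf sum_distrib_left trace_def inner_vec_def)
    finally show "\<rho>' t x = - divergence (\<lambda>y. \<rho> t y *\<^sub>R v t y) x"
      using t by (simp add: \<rho>'_def v algebra_simps)
  qed (use cont\<rho> cont\<rho>' time in auto)
  then show ?thesis by (simp add: \<rho>_def[abs_def])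
qed

section \<open>The sliced flow started from a Gaussian\<close>

lemma optimal_transport_map_projected_gauss:
  fixes S S' :: "real^'n^'n"
  assumes S: "pos_def S" "pos_def S'" and \<theta>: "\<theta> \<noteq> 0"
  shows "optimal_transport_map (projected_law \<theta> (gauss_density \<mu> S)) (projected_law \<theta> (gauss_density \<nu> S'))
    (\<lambda>s. \<theta> \<bullet> \<nu> + sqrt ((\<theta> \<bullet> (S' *v \<theta>)) / (\<theta> \<bullet> (S *v \<theta>))) * (s - \<theta> \<bullet> \<mu>))"
proof -
  let ?\<sigma> = "sqrt (\<theta> \<bullet> (S *v \<theta>))" and ?\<tau> = "sqrt (\<theta> \<bullet> (S' *v \<theta>))"
  have pos: "0 < ?\<sigma>" "0 < ?\<tau>" using S \<theta> by (simp_all add: pos_def_def)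
  have "(\<lambda>s. \<theta> \<bullet> \<nu> + ?\<tau> / ?\<sigma> * (s - \<theta> \<bullet> \<mu>)) = (\<lambda>s. (\<theta> \<bullet> \<nu> - ?\<tau> / ?\<sigma> * (\<theta> \<bullet> \<mu>)) + ?\<tau> / ?\<sigma> * s)"
    by (simp add: fun_eq_iff right_diff_distrib)
  moreover have "\<bar>?\<tau> / ?\<sigma>\<bar> * ?\<sigma> = ?\<tau>" using pos by (simp add: abs_of_pos)
  ultimately have "distr (density lborel (\<lambda>s. ennreal (normal_density (\<theta> \<bullet> \<mu>) ?\<sigma> s))) borel
      (\<lambda>s. \<theta> \<bullet> \<nu> + ?\<tau> / ?\<sigma> * (s - \<theta> \<bullet> \<mu>)) = density lborel (\<lambda>s. ennreal (normal_density (\<theta> \<bullet> \<nu>) ?\<tau> s))"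
    using distr_normal_density_affine[of "?\<tau> / ?\<sigma>" ?\<sigma> "\<theta> \<bullet> \<mu>" "\<theta> \<bullet> \<nu> - ?\<tau> / ?\<sigma> * (\<theta> \<bullet> \<mu>)"] pos
    by (simp only: diff_add_cancel) auto
  from optimal_transport_map_normal[OF pos this] show ?thesis
    by (simp only: projected_law_gauss[OF S(1) \<theta>] projected_law_gauss[OF S(2) \<theta>] real_sqrt_divide)
qed

lemma gain_mult_vec:
  fixes z :: "real^'n"
  shows "gain T Sf t S *v z = rate T t *\<^sub>R (sphere_matrix Sf S *v z - (1 / real CARD('n)) *\<^sub>R z)"
  by (simp only: gain_def bounded_bilinear.diff_left[OF bounded_bilinear_matrix_vector_mult]
      scaleR_matrix_vector_assoc[symmetric] matrix_vector_mul_lid)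

text \<open>Along \<open>\<theta>\<close> the displacement is \<open>\<theta> \<bullet> (z - m\<^sub>f)\<close> minus a multiple of \<open>\<theta> \<bullet> (z - m)\<close>. The first part
averages to \<open>(z - m\<^sub>f) / n\<close> by the second moments of the sphere, the second part to the sphere matrix
applied to \<open>z - m\<close>. Writing \<open>z - m\<^sub>f = (z - m) + (m - m\<^sub>f)\<close> separates the gain from the velocity of the
mean.\<close>

lemma sliced_velocity_affine:
  fixes S Sf :: "real^'n^'n" and m mf :: "real^'n"
  assumes S: "pos_def S"
    and \<T>: "\<And>\<theta> s. \<T> t \<theta> s = \<theta> \<bullet> mf + sqrt ((\<theta> \<bullet> (Sf *v \<theta>)) / (\<theta> \<bullet> (S *v \<theta>))) * (s - \<theta> \<bullet> m)"
  shows "integrable sphere_measure (\<lambda>\<theta>. (\<theta> \<bullet> z - \<T> t \<theta> (\<theta> \<bullet> z)) *\<^sub>R \<theta>)"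
    and "sliced_velocity T \<T> t z = gain T Sf t S *v (z - m) + - (rate T t / real CARD('n)) *\<^sub>R (m - mf)"
proof -
  let ?r = "\<lambda>\<theta>. sqrt ((\<theta> \<bullet> (Sf *v \<theta>)) / (\<theta> \<bullet> (S *v \<theta>)))"
  let ?M = "sphere_matrix Sf S"
  have split: "(\<theta> \<bullet> z - \<T> t \<theta> (\<theta> \<bullet> z)) *\<^sub>R \<theta> = (\<theta> \<bullet> (z - mf)) *\<^sub>R \<theta> - (?r \<theta> * (\<theta> \<bullet> (z - m))) *\<^sub>R \<theta>" for \<theta>
    by (simp add: \<T> inner_diff_right algebra_simps)
  have i1: "integrable sphere_measure (\<lambda>\<theta>. (\<theta> \<bullet> (z - mf)) *\<^sub>R \<theta>)"
    by (rule integrable_sphere_measure_continuous) (auto intro!: continuous_intros)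
  note M = sphere_matrix_mult_vec[OF S, of Sf "z - m"]
  show "integrable sphere_measure (\<lambda>\<theta>. (\<theta> \<bullet> z - \<T> t \<theta> (\<theta> \<bullet> z)) *\<^sub>R \<theta>)"
    unfolding split by (intro Bochner_Integration.integrable_diff i1 M(1))
  have "(\<integral>\<theta>. (\<theta> \<bullet> z - \<T> t \<theta> (\<theta> \<bullet> z)) *\<^sub>R \<theta> \<partial>sphere_measure)
      = (1 / real CARD('n)) *\<^sub>R (z - mf) - ?M *v (z - m)"
    unfolding split Bochner_Integration.integral_diff[OF i1 M(1)] M(2) integral_sphere_inner ..
  then have "sliced_velocity T \<T> t z = rate T t *\<^sub>R (?M *v (z - m)) - (rate T t / real CARD('n)) *\<^sub>R (z - mf)"
    by (simp add: sliced_velocity_def scaleR_right_diff_distrib)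
  also have "\<dots> = gain T Sf t S *v (z - m) + - (rate T t / real CARD('n)) *\<^sub>R (m - mf)"
    by (simp add: gain_mult_vec scaleR_right_diff_distrib)
  finally show "sliced_velocity T \<T> t z = gain T Sf t S *v (z - m) + - (rate T t / real CARD('n)) *\<^sub>R (m - mf)" .
qed

lemma gain_offset_centred:
  fixes m :: "real \<Rightarrow> real^'n" and mf z :: "real^'n"
  shows "gain T Sf t S *v z + offset T Sf mf m t S
    = gain T Sf t S *v (z - m t) + - (rate T t / real CARD('n)) *\<^sub>R (m t - mf)"
  by (simp add: gain_mult_vec offset_def scaleR_right_diff_distrib matrix_vector_mult_diff_distrib)

lemma continuous_on_gain:
  assumes S: "continuous_on {0..<T} S" and pos: "\<And>t. t \<in> {0..<T} \<Longrightarrow> pos_def (S t)"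
  shows "continuous_on {0..<T} (\<lambda>t. gain T Sf t (S t))"
proof -
  have "continuous_on {0..<T} (\<lambda>t. sphere_matrix Sf (S t))"
  proof (rule continuous_on_initial_intervals)
    fix b assume "b < T"
    then show "continuous_on {0..b} (\<lambda>t. sphere_matrix Sf (S t))"
      by (intro continuous_on_sphere_matrix continuous_on_subset[OF S] pos) auto
  qed
  then show ?thesis
    unfolding gain_def rate_def by (intro continuous_intros) auto
qed

theorem proposition2:
  fixes T :: real and m0 mf :: "real^'n" and \<Sigma>0 \<Sigma>f :: "real^'n^'n"
    and M :: "'w measure" and x :: "real \<Rightarrow> 'w \<Rightarrow> real^'n"
    and m :: "real \<Rightarrow> real^'n" and \<Sigma> :: "real \<Rightarrow> real^'n^'n"
  assumes "0 < T"
    and "pos_def \<Sigma>0" and "pos_def \<Sigma>f"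
    and "prob_space M"
    and "sliced_flow_solution M T (gauss_density m0 \<Sigma>0) (gauss_density mf \<Sigma>f) x"
    and "\<And>y. sliced_flow_solution M T (gauss_density m0 \<Sigma>0) (gauss_density mf \<Sigma>f) y \<Longrightarrow>
           (\<forall>\<omega>\<in>space M. y 0 \<omega> = x 0 \<omega>) \<Longrightarrow> (\<forall>t\<in>{0..<T}. \<forall>\<omega>\<in>space M. y t \<omega> = x t \<omega>)"
    and "covariance_solution T \<Sigma>0 \<Sigma>f \<Sigma>"
    and "\<And>S. covariance_solution T \<Sigma>0 \<Sigma>f S \<Longrightarrow> (\<forall>t\<in>{0..T}. S t = \<Sigma> t)"
    and "mean_solution T m0 mf m"
  shows "\<forall>t\<in>{0..<T}.
           (\<forall>\<omega>\<in>space M.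
              ((\<lambda>s. x s \<omega>) has_vector_derivative
                 (gain T \<Sigma>f t (\<Sigma> t) *v x t \<omega> + offset T \<Sigma>f mf m t (\<Sigma> t))) (at t within {0..<T})) \<and>
           distributed M lborel (x t) (\<lambda>z. ennreal (gauss_density (m t) (\<Sigma> t) z))"
proof -
  let ?I = "{0..<T}"
  let ?K = "\<lambda>t. gain T \<Sigma>f t (\<Sigma> t)"
  let ?m' = "\<lambda>t. - (rate T t / real CARD('n)) *\<^sub>R (m t - mf)"
  have \<Sigma>0: "\<Sigma> 0 = \<Sigma>0" and cont\<Sigma>: "continuous_on ?I \<Sigma>"
    and \<Sigma>': "\<And>t. t \<in> ?I \<Longrightarrow>
      (\<Sigma> has_vector_derivative ?K t ** \<Sigma> t + \<Sigma> t ** transpose (?K t)) (at t within ?I)"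
    using assms(7) unfolding covariance_solution_def by (auto elim: continuous_on_subset)
  have pos: "pos_def (\<Sigma> t)" if "t \<in> ?I" for t
    using assms(2,7) that unfolding covariance_solution_def by (cases "t = 0") auto
  have m0: "m 0 = m0" and m: "\<And>t. t \<in> ?I \<Longrightarrow> (m has_vector_derivative ?m' t) (at t within ?I)"
    using assms(9) unfolding mean_solution_def by auto
  have K: "continuous_on ?I ?K" by (rule continuous_on_gain[OF cont\<Sigma> pos])
  have "continuous_on ?I m"
    unfolding continuous_on_eq_continuous_within using has_vector_derivative_continuous[OF m] by blast
  then have m': "continuous_on ?I ?m'"
    unfolding rate_def by (intro continuous_intros) auto
  obtain \<Phi> \<Psi> where \<Phi>0: "\<Phi> 0 = mat 1"
    and \<Phi>: "\<And>t. t \<in> ?I \<Longrightarrow> (\<Phi> has_vector_derivative ?K t ** \<Phi> t) (at t within ?I)"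
    and \<Psi>\<Phi>: "\<And>t. t \<in> ?I \<Longrightarrow> \<Psi> t ** \<Phi> t = mat 1"
    and \<Sigma>\<Phi>: "\<And>t. t \<in> ?I \<Longrightarrow> \<Sigma> t = \<Phi> t ** \<Sigma> 0 ** transpose (\<Phi> t)"
    using covariance_by_fundamental_matrix[OF K \<Sigma>'] by metis
  \<comment> \<open>The candidate solution, with the transport maps that belong to its Gaussian laws.\<close>
  define y where "y t \<omega> = m t + \<Phi> t *v (x 0 \<omega> - m0)" for t \<omega>
  define \<T> where "\<T> t \<theta> s = \<theta> \<bullet> mf + sqrt ((\<theta> \<bullet> (\<Sigma>f *v \<theta>)) / (\<theta> \<bullet> (\<Sigma> t *v \<theta>))) * (s - \<theta> \<bullet> m t)"
    for t \<theta> s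
  have velocity: "integrable sphere_measure (\<lambda>\<theta>. (\<theta> \<bullet> z - \<T> t \<theta> (\<theta> \<bullet> z)) *\<^sub>R \<theta>)"
    "sliced_velocity T \<T> t z = ?K t *v (z - m t) + ?m' t" if "t \<in> ?I" for t z
    using sliced_velocity_affine[OF pos[OF that], of \<T>] by (simp_all add: \<T>_def)
  have y': "((\<lambda>s. y s \<omega>) has_vector_derivative ?K t *v (y t \<omega> - m t) + ?m' t) (at t within ?I)"
    if "t \<in> ?I" for t \<omega>
    using has_vector_derivative_add[OF m[OF that]
        bounded_linear.has_vector_derivative[OF bounded_linear_mult_vec \<Phi>[OF that], of "x 0 \<omega> - m0"]]
    by (simp add: y_def[abs_def] matrix_vector_mul_assoc add.commute)
  have x0: "distributed M lborel (x 0) (\<lambda>z. ennreal (gauss_density m0 \<Sigma>0 z))"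
    using assms(5) by (simp add: sliced_flow_solution_def)
  have y_law: "distributed M lborel (y t) (\<lambda>z. ennreal (gauss_density (m t) (\<Sigma> t) z))" if t: "t \<in> ?I" for t
  proof -
    have inv: "invertible (\<Phi> t)" unfolding invertible_left_inverse using \<Psi>\<Phi>[OF t] by blast
    have h [measurable]: "(\<lambda>z. m t + \<Phi> t *v (z - m0)) \<in> borel_measurable borel" by measurable
    have x0m [measurable]: "x 0 \<in> borel_measurable M" using x0 by (simp add: distributed_def)
    have "distr M lborel (y t) = distr (distr M borel (x 0)) borel (\<lambda>z. m t + \<Phi> t *v (z - m0))"
      by (subst distr_distr) (auto simp: o_def y_def[abs_def] cong: distr_cong)
    also have "distr M borel (x 0) = density lborel (\<lambda>z. ennreal (gauss_density m0 \<Sigma>0 z))"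
      using x0 by (simp add: distributed_def cong: distr_cong)
    also have "distr \<dots> borel (\<lambda>z. m t + \<Phi> t *v (z - m0)) = density lborel (\<lambda>z. ennreal (gauss_density (m t) (\<Sigma> t) z))"
      using distr_gauss_density_affine[OF inv assms(2)] \<Sigma>\<Phi>[OF t] by (simp add: \<Sigma>0)
    finally show ?thesis by (simp add: distributed_def y_def[abs_def])
  qed
  have continuity: "classical_continuity_equation T (gauss_density m0 \<Sigma>0) (sliced_velocity T \<T>)
      (\<lambda>t. gauss_density (m t) (\<Sigma> t))"
    using gaussian_continuity_equation[OF K \<Sigma>' pos m m' velocity(2) assms(1)] by (simp add: m0 \<Sigma>0)
  have "sliced_flow_solution M T (gauss_density m0 \<Sigma>0) (gauss_density mf \<Sigma>f) y"
    unfolding sliced_flow_solution_def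
  proof (intro conjI exI[of _ "\<lambda>t. gauss_density (m t) (\<Sigma> t)"] exI[of _ \<T>] ballI allI)
    show "distributed M lborel (y 0) (\<lambda>z. ennreal (gauss_density m0 \<Sigma>0 z))"
      using y_law[of 0] assms(1) by (simp add: m0 \<Sigma>0)
    show "classical_continuity_equation T (gauss_density m0 \<Sigma>0) (sliced_velocity T \<T>)
      (\<lambda>t. gauss_density (m t) (\<Sigma> t))" by (rule continuity)
  next
    fix t z assume t: "t \<in> ?I"
    show "0 \<le> gauss_density (m t) (\<Sigma> t) z"
      using pos_def_det[OF pos[OF t]] by (simp add: gauss_density_def)
    show "distributed M lborel (y t) (\<lambda>z. ennreal (gauss_density (m t) (\<Sigma> t) z))" by (rule y_law[OF t])
    show "integrable sphere_measure (\<lambda>\<theta>. (\<theta> \<bullet> z - \<T> t \<theta> (\<theta> \<bullet> z)) *\<^sub>R \<theta>)" by (rule velocity(1)[OF t])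
  next
    fix t and \<theta> :: "real^'n" assume "t \<in> ?I" "\<theta> \<in> sphere 0 1"
    then show "optimal_transport_map (projected_law \<theta> (gauss_density (m t) (\<Sigma> t)))
        (projected_law \<theta> (gauss_density mf \<Sigma>f)) (\<T> t \<theta>)"
      using optimal_transport_map_projected_gauss[OF pos assms(3), of t \<theta> "m t" mf]
      by (force simp: \<T>_def[abs_def])
  next
    fix \<omega> t assume "t \<in> ?I"
    then show "((\<lambda>s. y s \<omega>) has_vector_derivative sliced_velocity T \<T> t (y t \<omega>)) (at t within ?I)"
      using y' velocity(2) by simp
  qed
  moreover have "\<forall>\<omega>\<in>space M. y 0 \<omega> = x 0 \<omega>" by (simp add: y_def m0 \<Phi>0)
  ultimately have yx: "y t \<omega> = x t \<omega>" if "t \<in> ?I" "\<omega> \<in> space M" for t \<omega>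
    using assms(6) that by blast
  show ?thesis
  proof (intro ballI conjI)
    fix t \<omega> assume t: "t \<in> ?I" and \<omega>: "\<omega> \<in> space M"
    \<comment> \<open>The derivative at \<open>t\<close> is taken within \<open>[0, T)\<close>, where \<open>x\<close> and \<open>y\<close> agree.\<close>
    have "((\<lambda>s. x s \<omega>) has_vector_derivative ?K t *v (y t \<omega> - m t) + ?m' t) (at t within ?I)"
      by (rule has_vector_derivative_transform[OF t _ y'[OF t]]) (simp add: yx \<omega>)
    then show "((\<lambda>s. x s \<omega>) has_vector_derivative
        (?K t *v x t \<omega> + offset T \<Sigma>f mf m t (\<Sigma> t))) (at t within ?I)"
      by (simp only: gain_offset_centred yx[OF t \<omega>])
  next
    fix t assume t: "t \<in> ?I"
    have "x t \<in> measurable M lborel \<longleftrightarrow> y t \<in> measurable M lborel"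
      by (rule measurable_cong) (simp add: yx[OF t])
    moreover have "distr M lborel (x t) = distr M lborel (y t)"
      by (rule distr_cong) (simp_all add: yx[OF t])
    ultimately show "distributed M lborel (x t) (\<lambda>z. ennreal (gauss_density (m t) (\<Sigma> t) z))"
      using y_law[OF t] by (simp add: distributed_def)
  qed
qed

end
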